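(* Let $K$ be an imaginary quadratic field, and let $L_1=\mathbb{Z}+\mathbb{Z}\tau_1$ and $L_2=\mathbb{Z}+\mathbb{Z}\tau_2$ be lattices in $K$ (with $\tau_1,\tau_2\in K$) of conductors $f_1$ and $f_2$; put $E_i=\mathbb{C}/L_i$, $f=\mathrm{lcm}(f_1,f_2)$ and $\tilde E=\mathbb{C}/L_1L_2$. For $z\in\mathbb{C}$ let $S_z=\mathbb{C}^2/\Lambda_z$, where $\Lambda_z\subset\mathbb{C}^2$ is the $\mathbb{Z}$-span of the columns of \[\begin{pmatrix} \tau_{2} & 1 & z & 0\\ 0 & 0 & \tau_{1} & 1\end{pmatrix},\] so that $S_z$ is an extension $0\to E_2\to S_z\to E_1\to 0$ of complex tori. Suppose the image $P$ of $z$ in $\tilde E$ is a torsion point of order $n\ge1$. Then \[S_z \cong \mathbb{C}/\mathcal{O}_{nf} \oplus \tilde E/\langle P\rangle.\]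
   Context: $\mathcal{O}_m=\mathbb{Z}+m\mathcal{O}_K$; the conductor of a lattice $L\subset K$ is the $m$ with $\{\alpha\in K:\alpha L\subset L\}=\mathcal{O}_m$. $L_1L_2$ denotes the product lattice (the $\mathbb{Z}$-span of products). The map $z\mapsto S_z$ induces an isomorphism from $\tilde E$ onto the group of extension classes of $E_1$ by $E_2$ as complex tori. *)

theory Defs
  imports "HOL-Analysis.Analysis" "HOL-Computational_Algebra.Polynomial"
begin

definition imag_quadratic_field :: "complex set \<Rightarrow> bool" where
  "imag_quadratic_field K \<longleftrightarrow>
     (\<exists>d::int. d < 0 \<and> K = {of_rat a + of_rat b * csqrt (of_int d) | a b. True})"

definition ring_of_integers :: "complex set \<Rightarrow> complex set" where
  "ring_of_integers K = {x \<in> K. algebraic_int x}"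

definition order_cond :: "complex set \<Rightarrow> nat \<Rightarrow> complex set" where
  "order_cond K m = {of_int a + of_nat m * x | a x. x \<in> ring_of_integers K}"

definition zspan :: "'a::real_vector set \<Rightarrow> 'a set" where
  "zspan S = {\<Sum>s\<in>F. of_int (c s) *\<^sub>R s | F c. finite F \<and> F \<subseteq> S}"

definition is_conductor :: "complex set \<Rightarrow> complex set \<Rightarrow> nat \<Rightarrow> bool" where
  "is_conductor K L m \<longleftrightarrow> m > 0 \<and> {\<alpha> \<in> K. \<forall>x\<in>L. \<alpha> * x \<in> L} = order_cond K m"

definition prod_lattice :: "complex set \<Rightarrow> complex set \<Rightarrow> complex set" where
  "prod_lattice L1 L2 = zspan {x * y | x y. x \<in> L1 \<and> y \<in> L2}"

text \<open>Isomorphism of complex tori C^2/A and C^2/B: an invertible C-linear map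
  of C^2 carrying the lattice A onto the lattice B.\<close>
definition tori_iso :: "(complex \<times> complex) set \<Rightarrow> (complex \<times> complex) set \<Rightarrow> bool" where
  "tori_iso A B \<longleftrightarrow> (\<exists>p q r s :: complex. p * s - q * r \<noteq> 0 \<and>
      (\<lambda>(u, v). (p * u + q * v, r * u + s * v)) ` A = B)"

end

theory Submission
  imports Defs
begin

text \<open>
  Let \<open>\<Lambda>\<close> be the lattice of \<open>S\<^sub>z\<close>, let \<open>f\<close> be the least common multiple of the conductors, let
  \<open>\<omega>\<close> generate the maximal order and put \<open>\<theta> = n f \<omega>\<close>. That \<open>z\<close> has order exactly \<open>n\<close> means
  that the multiplier ring of \<open>\<Lambda>\<close> is exactly \<open>O = \<int> + \<int>\<theta>\<close>, so \<open>\<theta>\<close> acts on \<open>\<Lambda>/p\<Lambda>\<close> as a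
  non-scalar for every prime \<open>p\<close>. The Chinese remainder theorem then yields \<open>w \<in> \<Lambda>\<close> which is not an
  eigenvector of \<open>\<theta>\<close> modulo any prime. Hence the 2-by-2 minors of \<open>(w, \<theta>w)\<close> are coprime, some integral
  functional \<open>h\<close> on \<open>\<Lambda>\<close> has \<open>h(w) = 0\<close> and \<open>h(\<theta>w) = 1\<close>, and \<open>h\<close> is the \<open>\<theta>\<close>-coordinate of an
  \<open>O\<close>-linear map \<open>\<lambda> : \<Lambda> \<rightarrow> O\<close> with \<open>\<lambda>(w) = 1\<close>. The isomorphism is \<open>x \<mapsto> (\<lambda>(x), det(w, x))\<close>: the
  determinants \<open>det(x, y)\<close> with \<open>x, y \<in> \<Lambda>\<close> span \<open>L\<^sub>1L\<^sub>2 + \<int>z\<close>.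
\<close>

section \<open>Subgroups and integral spans\<close>

definition subgrp :: "'a::ab_group_add set \<Rightarrow> bool" where
  "subgrp G \<longleftrightarrow> 0 \<in> G \<and> (\<forall>x\<in>G. \<forall>y\<in>G. x - y \<in> G)"

lemma subgrp_zero: "subgrp G \<Longrightarrow> 0 \<in> G"
  by (simp add: subgrp_def)

lemma subgrp_diff: "subgrp G \<Longrightarrow> x \<in> G \<Longrightarrow> y \<in> G \<Longrightarrow> x - y \<in> G"
  by (simp add: subgrp_def)

lemma subgrp_minus: "subgrp G \<Longrightarrow> x \<in> G \<Longrightarrow> - x \<in> G"
  using subgrp_diff[of G 0 x] subgrp_zero[of G] by simp

lemma subgrp_add: "subgrp G \<Longrightarrow> x \<in> G \<Longrightarrow> y \<in> G \<Longrightarrow> x + y \<in> G"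
  using subgrp_diff[of G x "- y"] subgrp_minus[of G y] by simp

lemma subgrp_nat_scaleR:
  fixes G :: "'a::real_vector set"
  assumes "subgrp G" "x \<in> G"
  shows "real k *\<^sub>R x \<in> G"
  by (induction k) (auto simp: algebra_simps subgrp_zero subgrp_add assms)

lemma subgrp_int_scaleR:
  fixes G :: "'a::real_vector set"
  assumes "subgrp G" "x \<in> G"
  shows "real_of_int k *\<^sub>R x \<in> G"
  using subgrp_nat_scaleR[OF assms, of "nat k"] subgrp_minus[OF assms(1) subgrp_nat_scaleR[OF assms, of "nat (-k)"]]
  by (cases "k \<ge> 0") auto

lemma subgrp_int_mult:
  fixes G :: "complex set"
  assumes "subgrp G" "x \<in> G"
  shows "of_int k * x \<in> G"
  using subgrp_int_scaleR[OF assms, of k] by (simp add: scaleR_conv_of_real)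

lemma subgrp_sum: "subgrp G \<Longrightarrow> (\<And>i. i \<in> I \<Longrightarrow> f i \<in> G) \<Longrightarrow> sum f I \<in> G"
  by (induction I rule: infinite_finite_induct) (auto simp: subgrp_zero subgrp_add)

lemma zspan_least:
  fixes G :: "'a::real_vector set"
  assumes "subgrp G" "S \<subseteq> G"
  shows "zspan S \<subseteq> G"
  unfolding zspan_def using assms by (auto intro!: subgrp_sum subgrp_int_scaleR)

lemma zspan_superset: "S \<subseteq> zspan S"
proof
  fix x assume "x \<in> S"
  thus "x \<in> zspan S" unfolding zspan_def
    by (intro CollectI exI[of _ "{x}"] exI[of _ "\<lambda>_. 1"]) auto
qed

lemma subgrp_zspan: "subgrp (zspan S)"
  unfolding subgrp_def
proof (intro conjI ballI)
  show "0 \<in> zspan S" unfolding zspan_def by (auto intro!: exI[of _ "{}"])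
  fix x y assume "x \<in> zspan S" "y \<in> zspan S"
  then obtain F c G d where F: "finite F" "F \<subseteq> S" "x = (\<Sum>s\<in>F. of_int (c s) *\<^sub>R s)"
    and G: "finite G" "G \<subseteq> S" "y = (\<Sum>s\<in>G. of_int (d s) *\<^sub>R s)"
    unfolding zspan_def by auto
  let ?c = "\<lambda>s. if s \<in> F then c s else 0" and ?d = "\<lambda>s. if s \<in> G then d s else 0"
  have "x = (\<Sum>s\<in>F\<union>G. of_int (?c s) *\<^sub>R s)"
    unfolding F(3) using F(1) G(1) by (intro sum.mono_neutral_cong_left) auto
  moreover have "y = (\<Sum>s\<in>F\<union>G. of_int (?d s) *\<^sub>R s)"
    unfolding G(3) using F(1) G(1) by (intro sum.mono_neutral_cong_left) auto
  ultimately have "x - y = (\<Sum>s\<in>F\<union>G. of_int (?c s - ?d s) *\<^sub>R s)"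
    by (simp only: of_int_diff scaleR_left_diff_distrib sum_subtractf)
  thus "x - y \<in> zspan S" unfolding zspan_def using F G
    by (intro CollectI exI[of _ "F \<union> G"] exI[of _ "\<lambda>s. ?c s - ?d s"]) auto
qed

lemma zspan_eqI: "subgrp G \<Longrightarrow> S \<subseteq> G \<Longrightarrow> G \<subseteq> zspan S \<Longrightarrow> zspan S = G"
  using zspan_least by blast

definition lat :: "complex \<Rightarrow> complex set" where
  "lat \<tau> = {of_int a + of_int b * \<tau> | a b. True}"

lemma latI: "of_int a + of_int b * \<tau> \<in> lat \<tau>"
  by (auto simp: lat_def)

lemma subgrp_lat: "subgrp (lat \<tau>)"
  unfolding subgrp_def
proof (intro conjI ballI)
  show "0 \<in> lat \<tau>" using latI[of 0 0 \<tau>] by simp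
  fix x y assume "x \<in> lat \<tau>" "y \<in> lat \<tau>"
  then obtain a b c d where "x = of_int a + of_int b * \<tau>" "y = of_int c + of_int d * \<tau>"
    by (auto simp: lat_def)
  hence "x - y = of_int (a - c) + of_int (b - d) * \<tau>" by (simp add: algebra_simps)
  thus "x - y \<in> lat \<tau>" by (simp only: latI)
qed

lemma one_in_lat: "1 \<in> lat \<tau>" and gen_in_lat: "\<tau> \<in> lat \<tau>"
  using latI[of 1 0 \<tau>] latI[of 0 1 \<tau>] by auto

lemma zspan_pair_eq_lat: "zspan {1, \<tau>} = lat \<tau>"
proof (rule zspan_eqI[OF subgrp_lat])
  show "{1, \<tau>} \<subseteq> lat \<tau>" using one_in_lat gen_in_lat by auto
  have "1 \<in> zspan {1, \<tau>}" "\<tau> \<in> zspan {1, \<tau>}" using zspan_superset[of "{1, \<tau>}"] by auto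
  hence "of_int a * 1 + of_int b * \<tau> \<in> zspan {1, \<tau>}" for a b
    by (intro subgrp_add subgrp_int_mult subgrp_zspan)
  thus "lat \<tau> \<subseteq> zspan {1, \<tau>}" by (auto simp: lat_def)
qed

lemma int_comb_eq_iff:
  assumes "Im \<tau> \<noteq> 0"
  shows "of_int a + of_int b * \<tau> = of_int c + of_int d * \<tau> \<longleftrightarrow> a = c \<and> b = d"
  using assms by (auto simp: complex_eq_iff)

section \<open>Orders in imaginary quadratic fields\<close>

lemma imag_quadratic_field_rat_comb:
  assumes "imag_quadratic_field K" "x \<in> K"
  shows "of_rat r + of_rat s * x \<in> K"
proof -
  obtain d where K: "K = {of_rat a + of_rat b * csqrt (of_int d) | a b. True}"
    using assms(1) by (auto simp: imag_quadratic_field_def)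
  obtain a b where "x = of_rat a + of_rat b * csqrt (of_int d)" using assms(2) K by auto
  hence "of_rat r + of_rat s * x = of_rat (r + s * a) + of_rat (s * b) * csqrt (of_int d)"
    by (simp add: of_rat_add of_rat_mult algebra_simps)
  thus ?thesis using K by blast
qed

section \<open>Primitive integral equations and the multiplier rings they determine\<close>

lemma rat_pair_common_denom:
  obtains q a1 b1 :: int where "q > 0" "a = of_int a1 / (of_int q :: rat)"
      "b = (of_int b1 :: rat) / of_int q"
proof -
  obtain a1 q1 where "quotient_of a = (a1, q1)" by (cases "quotient_of a")
  note a = quotient_of_div[OF this] quotient_of_denom_pos[OF this]
  obtain b1 q2 where "quotient_of b = (b1, q2)" by (cases "quotient_of b")
  note b = quotient_of_div[OF this] quotient_of_denom_pos[OF this]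
  show ?thesis
    by (rule that[of "q1 * q2" "a1 * q2" "b1 * q1"]) (use a b in \<open>auto simp: field_simps\<close>)
qed

lemma primitive_quadratic_equation:
  assumes "imag_quadratic_field K" "x \<in> K"
  obtains A B C :: int where "gcd A (gcd B C) = 1" "of_int A * x\<^sup>2 + of_int B * x + of_int C = 0"
proof -
  obtain d where K: "K = {of_rat a + of_rat b * csqrt (of_int d) | a b. True}"
    using assms(1) by (auto simp: imag_quadratic_field_def)
  obtain a b where x: "x = of_rat a + of_rat b * csqrt (of_int d)" using assms(2) K by auto
  obtain q a1 b1 where q: "q > 0" "a = of_int a1 / of_int q" "b = of_int b1 / of_int q"
    by (rule rat_pair_common_denom)
  have "of_int q * x = of_int a1 + of_int b1 * csqrt (of_int d)"
    using q(1) by (simp add: x q(2,3) of_rat_divide field_simps)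
  hence "(of_int q * x - of_int a1)\<^sup>2 = of_int (b1\<^sup>2 * d)"
    by (simp add: power_mult_distrib)
  hence eq: "of_int (q\<^sup>2) * x\<^sup>2 + of_int (- 2 * q * a1) * x + of_int (a1\<^sup>2 - b1\<^sup>2 * d) = 0"
    by (simp add: power2_eq_square algebra_simps)
  \<comment> \<open>Dividing by the content makes the equation primitive; \<open>q > 0\<close> keeps
    \<open>h\<close> nonzero.\<close>
  define h where "h = gcd (q\<^sup>2) (gcd (- 2 * q * a1) (a1\<^sup>2 - b1\<^sup>2 * d))"
  have h0: "h \<noteq> 0" using q by (auto simp: h_def)
  obtain A where A: "q\<^sup>2 = h * A" unfolding h_def by (meson gcd_dvd1 dvdE)
  obtain B where B: "- 2 * q * a1 = h * B"
    unfolding h_def by (meson gcd_dvd1 gcd_dvd2 dvdE dvd_trans)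
  obtain C where C: "a1\<^sup>2 - b1\<^sup>2 * d = h * C" unfolding h_def by (meson gcd_dvd2 dvdE dvd_trans)
  have "\<bar>h\<bar> * gcd A (gcd B C) = \<bar>h\<bar>"
    using h_def unfolding A B C by (metis abs_gcd_int abs_idempotent gcd_mult_distrib_int)
  hence "gcd A (gcd B C) = 1" using h0 by simp
  moreover have "of_int h * (of_int A * x\<^sup>2 + of_int B * x + of_int C) = 0"
    using eq unfolding A B C by (simp add: algebra_simps)
  hence "of_int A * x\<^sup>2 + of_int B * x + of_int C = 0" using h0 by simp
  ultimately show ?thesis by (rule that)
qed

lemma primitive_lead_nonzero:
  assumes "Im \<tau> \<noteq> 0" "gcd A (gcd B C) = 1" "of_int A * \<tau>\<^sup>2 + of_int B * \<tau> + of_int C = 0"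
  shows "A \<noteq> 0"
proof
  assume "A = 0"
  hence "of_int C + of_int B * \<tau> = of_int 0 + of_int 0 * \<tau>"
    using assms(3) by (simp add: add.commute)
  hence "B = 0" "C = 0" using int_comb_eq_iff[OF assms(1)] by blast+
  thus False using assms(2) \<open>A = 0\<close> by simp
qed

text \<open>Gauss's lemma: a primitive quadratic with the nonreal root \<open>x\<close> divides,
  over the integers, the monic polynomial that vanishes at \<open>x\<close>, so its leading
  coefficient divides 1.\<close>

lemma primitive_equation_of_algebraic_int_monic:
  fixes x :: complex
  assumes "algebraic_int x" "Im x \<noteq> 0" "gcd A (gcd B C) = 1"
    and eq: "of_int A * x\<^sup>2 + of_int B * x + of_int C = 0"
  shows "\<bar>A\<bar> = 1"
proof -
  have "A \<noteq> 0" by (rule primitive_lead_nonzero[OF assms(2-4)])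
  obtain P :: "int poly" where P: "poly (map_poly of_int P) x = 0" "lead_coeff P = 1"
    using assms(1) by (auto simp: algebraic_int_altdef_ipoly)
  define T where "T = [:C, B, A:]"
  have T: "T \<noteq> 0" "degree T = 2" using \<open>A \<noteq> 0\<close> by (auto simp: T_def)
  \<comment> \<open>Pseudo-division keeps integer coefficients at the cost of the factor
    \<open>a\<close>. The remainder has degree at most 1 and vanishes at the nonreal
    \<open>x\<close>, so it is zero.\<close>
  define R where "R = pseudo_mod P T"
  obtain a S where aS: "a \<noteq> 0" "smult a P = T * S + R" using pseudo_mod(1)[OF T(1)] R_def by metis
  have R: "degree R < 2" using pseudo_mod(2)[OF T(1), of P] T(2) by (auto simp: R_def)
  have Tx: "poly (map_poly of_int T) x = 0"
    using eq by (simp add: T_def map_poly_pCons power2_eq_square algebra_simps)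
  have map_poly_simps: "map_poly of_int (p * q) = map_poly (of_int :: int \<Rightarrow> complex) p * map_poly of_int q"
    "map_poly of_int (p + q) = map_poly (of_int :: int \<Rightarrow> complex) p + map_poly of_int q"
    "map_poly of_int (smult c p) = smult (of_int c :: complex) (map_poly of_int p)" for p q c
    by (auto intro!: poly_eqI simp: coeff_map_poly coeff_mult)
  have "poly (map_poly of_int (smult a P)) x = poly (map_poly of_int (T * S + R)) x"
    using aS by simp
  hence Rx: "poly (map_poly of_int R) x = 0" using P Tx by (simp add: map_poly_simps)
  have Req: "R = [:coeff R 0, coeff R 1:]"
    using R by (intro poly_eqI) (auto simp: coeff_pCons coeff_eq_0 split: nat.splits)
  hence "of_int (coeff R 0) + of_int (coeff R 1) * x = 0"
  proof -
    have "poly (map_poly of_int [:coeff R 0, coeff R 1:]) x = 0" using Rx Req by simp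
    thus ?thesis by (simp add: map_poly_pCons mult.commute)
  qed
  hence "coeff R 0 = 0" "coeff R 1 = 0"
    using int_comb_eq_iff[OF assms(2), of "coeff R 0" "coeff R 1" 0 0] by simp_all
  hence "R = 0" using Req by simp
  \<comment> \<open>\<open>P\<close> and \<open>T\<close> are primitive, so \<open>a\<close> is up
    to sign the content of \<open>S\<close> and can be cancelled.\<close>
  have "content P dvd 1" using content_dvd_coeff[of P "degree P"] P(2) by simp
  hence "content P = 1" using is_unit_content_iff by blast
  have "content T dvd gcd A (gcd B C)"
    using content_dvd_coeff[of T 0] content_dvd_coeff[of T 1] content_dvd_coeff[of T 2]
    by (simp add: T_def numeral_2_eq_2)
  hence "content T = 1" using assms(3) is_unit_content_iff by metis
  have "content (smult a P) = content (T * S)" using aS \<open>R = 0\<close> by simp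
  hence "content S = \<bar>a\<bar>" using \<open>content P = 1\<close> \<open>content T = 1\<close> by (simp add: content_mult)
  hence "[:a:] dvd S" by (simp add: const_poly_dvd_iff_dvd_content)
  then obtain S' where "S = smult a S'" by (auto simp: dvd_def)
  hence "smult a P = smult a (T * S')" using aS \<open>R = 0\<close> by simp
  hence "P = T * S'" using aS(1) by (metis smult_cancel)
  hence "lead_coeff T * lead_coeff S' = 1" using P(2) by (metis lead_coeff_mult)
  moreover have "lead_coeff T = A" using T(2) by (simp add: T_def numeral_2_eq_2)
  ultimately show ?thesis by (auto simp: zmult_eq_1_iff)
qed

lemma lat_coeffs_in_latD:
  assumes "Im \<tau> \<noteq> 0" "of_int c * (of_int a + of_int b * \<tau>) = of_int d * y" "y \<in> lat \<tau>"
  shows "d dvd c * a" "d dvd c * b"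
proof -
  obtain r s where y: "y = of_int r + of_int s * \<tau>" using assms(3) by (auto simp: lat_def)
  have "of_int (c * a) + of_int (c * b) * \<tau> = of_int (d * r) + of_int (d * s) * \<tau>"
    using assms(2) by (simp add: y algebra_simps)
  hence "c * a = d * r" "c * b = d * s" using int_comb_eq_iff[OF assms(1)] by blast+
  thus "d dvd c * a" "d dvd c * b" by auto
qed

text \<open>A multiplier maps 1 into the lattice, so it is \<open>a + b * \<tau>\<close>. Applied to
  \<open>\<tau>\<close> it brings in \<open>b * \<tau>\<^sup>2\<close>, with coordinates
  \<open>- b * B / A\<close> and \<open>- b * C / A\<close>; by primitivity these are integers only
  if \<open>A dvd b\<close>.\<close>

lemma lat_multiplier_iff:
  assumes "Im \<tau> \<noteq> 0" and g: "gcd A (gcd B C) = 1"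
    and eq: "of_int A * \<tau>\<^sup>2 + of_int B * \<tau> + of_int C = 0"
  shows "(\<forall>x\<in>lat \<tau>. \<alpha> * x \<in> lat \<tau>) \<longleftrightarrow> \<alpha> \<in> lat (of_int A * \<tau>)"
proof
  assume L: "\<forall>x\<in>lat \<tau>. \<alpha> * x \<in> lat \<tau>"
  hence "\<alpha> * 1 \<in> lat \<tau>" using one_in_lat by blast
  then obtain a b where \<alpha>: "\<alpha> = of_int a + of_int b * \<tau>" by (auto simp: lat_def)
  have "\<alpha> * \<tau> \<in> lat \<tau>" using L gen_in_lat by blast
  hence "of_int a * \<tau> - \<alpha> * \<tau> \<in> lat \<tau>"
    by (intro subgrp_diff subgrp_int_mult subgrp_lat gen_in_lat)
  moreover have "of_int b * (of_int C + of_int B * \<tau>) = of_int A * (of_int a * \<tau> - \<alpha> * \<tau>)"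
  proof -
    have "of_int C + of_int B * \<tau> = - (of_int A * \<tau>\<^sup>2)" using eq by algebra
    thus ?thesis by (simp add: \<alpha> power2_eq_square algebra_simps)
  qed
  ultimately have "A dvd b * C" "A dvd b * B" using lat_coeffs_in_latD[OF assms(1)] by blast+
  moreover have "A dvd b * A" by simp
  ultimately have "A dvd gcd (b * A) (gcd (b * B) (b * C))" by simp
  also have "gcd (b * A) (gcd (b * B) (b * C)) = \<bar>b\<bar>"
    using g
      by (metis gcd_mult_distrib_int abs_gcd_int abs_mult mult.right_neutral gcd_abs1_int gcd_abs2_int)
  finally obtain c where "b = A * c" by auto
  hence "\<alpha> = of_int a + of_int c * (of_int A * \<tau>)" by (simp add: \<alpha>)
  thus "\<alpha> \<in> lat (of_int A * \<tau>)" by (simp only: latI)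
next
  assume "\<alpha> \<in> lat (of_int A * \<tau>)"
  then obtain a b where \<alpha>: "\<alpha> = of_int a + of_int b * (of_int A * \<tau>)" by (auto simp: lat_def)
  show "\<forall>x\<in>lat \<tau>. \<alpha> * x \<in> lat \<tau>"
  proof
    fix x assume "x \<in> lat \<tau>"
    then obtain c d where x: "x = of_int c + of_int d * \<tau>" by (auto simp: lat_def)
    have "\<alpha> * x = of_int a * x + of_int (b * c * A) * \<tau> + of_int (b * d) * (of_int A * \<tau>\<^sup>2)"
      by (simp add: \<alpha> x power2_eq_square algebra_simps)
    also have "of_int A * \<tau>\<^sup>2 = - of_int B * \<tau> - of_int C" using eq by algebra
    also have "of_int a * x + of_int (b * c * A) * \<tau> + of_int (b * d) * (- of_int B * \<tau> - of_int C)
      = of_int (a * c - b * d * C) + of_int (a * d + b * c * A - b * d * B) * \<tau>"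
      by (simp add: x algebra_simps)
    finally show "\<alpha> * x \<in> lat \<tau>" by (simp only: latI)
  qed
qed

text \<open>The multipliers in \<open>is_conductor\<close> range over \<open>K\<close>; as
  \<open>lat (of_int A * \<tau>)\<close> lies in \<open>K\<close>, they are the complex multipliers
  found above.\<close>

lemma conductor_order_eq:
  assumes K: "imag_quadratic_field K" "\<tau> \<in> K" and "Im \<tau> \<noteq> 0" "gcd A (gcd B C) = 1"
    "of_int A * \<tau>\<^sup>2 + of_int B * \<tau> + of_int C = 0" "is_conductor K (lat \<tau>) m"
  shows "order_cond K m = lat (of_int A * \<tau>)"
proof -
  have "lat (of_int A * \<tau>) \<subseteq> K"
  proof
    fix x assume "x \<in> lat (of_int A * \<tau>)"
    then obtain a b where "x = of_int a + of_int b * (of_int A * \<tau>)" by (auto simp: lat_def)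
    thus "x \<in> K" using imag_quadratic_field_rat_comb[OF K, of "of_int a" "of_int (b * A)"]
      by (simp add: of_rat_mult mult.assoc)
  qed
  thus ?thesis
    using lat_multiplier_iff[OF assms(3-5)] assms(6) unfolding is_conductor_def by blast
qed

section \<open>Generators of the maximal order\<close>

lemma quadratic_integer_trace_norm:
  fixes T N :: int
  assumes "Im x \<noteq> 0" "x\<^sup>2 = of_int T * x - of_int N"
  shows "2 * Re x = of_int T" "(Re x)\<^sup>2 + (Im x)\<^sup>2 = of_int N"
proof -
  have 1: "(Re x)\<^sup>2 - (Im x)\<^sup>2 = of_int T * Re x - of_int N" "2 * Re x * Im x = of_int T * Im x"
    using assms(2) by (auto simp: complex_eq_iff power2_eq_square)
  thus T: "2 * Re x = of_int T" using assms(1) by simp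
  have "of_int T * Re x = 2 * (Re x)\<^sup>2" using T by (simp add: power2_eq_square)
  thus "(Re x)\<^sup>2 + (Im x)\<^sup>2 = of_int N" using 1(1) by simp
qed

lemma ring_of_integers_quadratic:
  assumes "imag_quadratic_field K" "x \<in> ring_of_integers K" "Im x \<noteq> 0"
  obtains T N :: int where "x\<^sup>2 = of_int T * x - of_int N"
proof -
  have x: "x \<in> K" "algebraic_int x" using assms(2) by (auto simp: ring_of_integers_def)
  obtain A B C where ABC: "gcd A (gcd B C) = 1" "of_int A * x\<^sup>2 + of_int B * x + of_int C = 0"
    using primitive_quadratic_equation[OF assms(1) x(1)] by blast
  have "\<bar>A\<bar> = 1" using primitive_equation_of_algebraic_int_monic[OF x(2) assms(3) ABC] .
  hence "A = 1 \<or> A = -1" by linarith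
  thus ?thesis
  proof
    assume "A = 1"
    hence "x\<^sup>2 + of_int B * x + of_int C = 0" using ABC(2) by simp
    hence "x\<^sup>2 = of_int (- B) * x - of_int C" by (simp add: eq_neg_iff_add_eq_0 algebra_simps)
    thus ?thesis by (rule that)
  next
    assume "A = -1"
    hence "- x\<^sup>2 + of_int B * x + of_int C = 0" using ABC(2) by simp
    hence "x\<^sup>2 = of_int B * x - of_int (- C)" by (simp add: algebra_simps)
    thus ?thesis by (rule that)
  qed
qed

lemma algebraic_int_monic_quadratic:
  fixes x :: complex and b c :: int
  assumes "x\<^sup>2 + of_int b * x + of_int c = 0"
  shows "algebraic_int x"
  unfolding algebraic_int_altdef_ipoly
  by (rule exI[of _ "[:c, b, 1:]"]) (use assms in \<open>simp add: map_poly_pCons power2_eq_square algebra_simps\<close>)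

text \<open>A generator is read off from the given order, without a case distinction on the
  discriminant: \<open>\<theta> = a + m * \<omega>\<close> with \<open>\<omega>\<close> integral.
  Any integral \<open>x\<close> in \<open>K\<close> is then \<open>q + c * \<omega>\<close> with
  \<open>q\<close> rational, and \<open>q\<close> turns out to be an algebraic integer, hence an
  integer.\<close>

lemma ring_of_integers_generator:
  assumes K: "imag_quadratic_field K" and "Im \<theta> \<noteq> 0" "m > 0" and ord: "order_cond K m = lat \<theta>"
  obtains \<omega> and k T N :: int where "of_nat m * \<omega> = \<theta> + of_int k" "Im \<omega> \<noteq> 0"
    "\<omega>\<^sup>2 = of_int T * \<omega> - of_int N" "ring_of_integers K = lat \<omega>"
proof -
  have "\<theta> \<in> order_cond K m" using ord gen_in_lat by simp
  then obtain a \<omega> where \<omega>: "\<theta> = of_int a + of_nat m * \<omega>" "\<omega> \<in> ring_of_integers K"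
    by (auto simp: order_cond_def)
  have Im: "Im \<omega> \<noteq> 0" using assms(2) \<omega>(1) by auto
  obtain T N where TN: "\<omega>\<^sup>2 = of_int T * \<omega> - of_int N"
    using ring_of_integers_quadratic[OF K \<omega>(2) Im] by blast
  note tn = quadratic_integer_trace_norm[OF Im TN]
  have "ring_of_integers K = lat \<omega>"
  proof
    show "ring_of_integers K \<subseteq> lat \<omega>"
    proof
      fix x assume x: "x \<in> ring_of_integers K"
      hence "of_int 0 + of_nat m * x \<in> order_cond K m" unfolding order_cond_def by blast
      hence "of_nat m * x \<in> lat \<theta>" using ord by simp
      then obtain b c where bc: "of_nat m * x = of_int b + of_int c * \<theta>" by (auto simp: lat_def)
      define q :: real where "q = of_int (b + c * a) / of_nat m"
      have xq: "x = of_real q + of_int c * \<omega>"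
        using bc \<omega>(1) \<open>m > 0\<close> by (simp add: q_def field_simps)
      have "algebraic_int (of_real q :: complex)"
      proof (cases "c = 0")
        case True
        thus ?thesis using xq x by (simp add: ring_of_integers_def)
      next
        case False
        have Imx: "Im x = of_int c * Im \<omega>" by (simp add: xq)
        hence "Im x \<noteq> 0" using False Im by simp
        then obtain T' N' where TN': "x\<^sup>2 = of_int T' * x - of_int N'"
          using ring_of_integers_quadratic[OF K x] by blast
        note tn' = quadratic_integer_trace_norm[OF \<open>Im x \<noteq> 0\<close> TN']
        \<comment> \<open>Equating \<open>N'\<close>, the norm of the nonreal \<open>x\<close>, with
          the norm of \<open>q + c * \<omega>\<close> gives a monic integral quadratic equation for
          \<open>q\<close>.\<close>
        have Rex: "Re x = q + of_int c * Re \<omega>" by (simp add: xq)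
        have "q\<^sup>2 + of_int (c * T) * q + of_int (c\<^sup>2 * N - N') = 0"
          unfolding of_int_diff of_int_mult tn(2)[symmetric] tn'(2)[symmetric] tn(1)[symmetric]
          by (simp add: Rex Imx power2_eq_square algebra_simps)
        hence "of_real (q\<^sup>2 + of_int (c * T) * q + of_int (c\<^sup>2 * N - N')) = (0 :: complex)"
          by simp
        hence "(of_real q :: complex)\<^sup>2 + of_int (c * T) * of_real q + of_int (c\<^sup>2 * N - N') = 0"
          by simp
        thus ?thesis by (rule algebraic_int_monic_quadratic)
      qed
      hence "(of_real q :: complex) \<in> \<int>" by (intro rational_algebraic_int_is_int) (auto simp: q_def)
      then obtain e where "(of_real q :: complex) = of_int e" by (auto elim: Ints_cases)
      thus "x \<in> lat \<omega>" using xq latI by simp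
    qed
    show "lat \<omega> \<subseteq> ring_of_integers K"
    proof
      fix x assume "x \<in> lat \<omega>"
      then obtain a b where x: "x = of_int a + of_int b * \<omega>" by (auto simp: lat_def)
      have "x\<^sup>2 + of_int (- (2 * a + b * T)) * x + of_int (a\<^sup>2 + a * b * T + b\<^sup>2 * N)
        = of_int (b\<^sup>2) * (\<omega>\<^sup>2 - of_int T * \<omega> + of_int N)"
        by (simp add: x power2_eq_square algebra_simps)
      also have "\<dots> = 0" using TN by simp
      finally have "algebraic_int x" by (rule algebraic_int_monic_quadratic)
      moreover have "x \<in> K"
        using imag_quadratic_field_rat_comb[OF K, of \<omega> "of_int a" "of_int b"] \<omega>(2)
        by (simp add: x ring_of_integers_def)
      ultimately show "x \<in> ring_of_integers K" by (simp add: ring_of_integers_def)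
    qed
  qed
  moreover have "of_nat m * \<omega> = \<theta> + of_int (- a)" using \<omega>(1) by simp
  ultimately show ?thesis using that Im TN by blast
qed

lemma order_cond_eq_lat:
  assumes "ring_of_integers K = lat \<omega>"
  shows "order_cond K m = lat (of_nat m * \<omega>)"
proof (intro equalityI subsetI)
  fix x assume "x \<in> order_cond K m"
  then obtain a c d where "x = of_int a + of_nat m * (of_int c + of_int d * \<omega>)"
    by (auto simp: order_cond_def assms lat_def)
  hence "x = of_int (a + int m * c) + of_int d * (of_nat m * \<omega>)" by (simp add: algebra_simps)
  thus "x \<in> lat (of_nat m * \<omega>)" by (simp only: latI)
next
  fix x assume "x \<in> lat (of_nat m * \<omega>)"
  then obtain a d where "x = of_int a + of_nat m * (of_int 0 + of_int d * \<omega>)"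
    by (auto simp: lat_def algebra_simps)
  thus "x \<in> order_cond K m" unfolding order_cond_def assms using latI by blast
qed

text \<open>Each generator is an integral combination of 1 and the other; the two leading
  coefficients multiply to 1.\<close>

lemma lat_eq_imp_generators:
  assumes "Im \<theta> \<noteq> 0" "lat \<theta> = lat \<eta>"
  obtains e k :: int where "\<bar>e\<bar> = 1" "\<theta> = of_int e * \<eta> + of_int k"
proof -
  obtain k e where 1: "\<theta> = of_int k + of_int e * \<eta>"
    using assms(2) gen_in_lat[of \<theta>] by (auto simp: lat_def)
  obtain k' e' where 2: "\<eta> = of_int k' + of_int e' * \<theta>" using assms(2) gen_in_lat[of \<eta>]
    unfolding lat_def by blast
  have "of_int 0 + of_int 1 * \<theta> = of_int (k + e * k') + of_int (e * e') * \<theta>"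
    using 1 unfolding 2 by (simp add: algebra_simps)
  hence "e * e' = 1" using int_comb_eq_iff[OF assms(1)] by metis
  hence "\<bar>e\<bar> = 1" by (auto simp: zmult_eq_1_iff)
  thus ?thesis using 1 that by (simp add: add.commute)
qed

section \<open>Bezout relations, Chinese remainders and subgroups of the integers\<close>

lemma primitive_bezout:
  assumes "gcd A (gcd B C) = (1::int)"
  obtains x y w where "x * A + y * B + w * C = 1"
proof -
  obtain u v where uv: "u * A + v * gcd B C = 1" using bezout_int[of A "gcd B C"] assms by metis
  obtain s t where "s * B + t * C = gcd B C" using bezout_int by blast
  hence "u * A + (v * s) * B + (v * t) * C = 1"
    using uv by (metis (no_types) add.assoc distrib_left mult.assoc)
  thus ?thesis by (rule that)
qed

text \<open>The Chinese remainder theorem for vectors: by \<open>inv\<close>, the truth of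
  \<open>P p w\<close> depends only on the class of \<open>w\<close> modulo \<open>p\<close> times
  \<open>G\<close>, so local solutions can be glued one prime at a time.\<close>

lemma subgrp_crt:
  fixes G :: "'a::real_vector set" and S :: "int set"
  assumes G: "subgrp G" and S: "finite S" "\<And>p. p \<in> S \<Longrightarrow> prime p"
    and ex: "\<And>p. p \<in> S \<Longrightarrow> \<exists>w\<in>G. P p w"
    and inv: "\<And>p w v. p \<in> S \<Longrightarrow> w \<in> G \<Longrightarrow> v \<in> G \<Longrightarrow> P p w \<Longrightarrow> P p (w + of_int p *\<^sub>R v)"
  shows "\<exists>w\<in>G. \<forall>p\<in>S. P p w"
  using S ex inv
proof (induction S)
  case empty
  show ?case using subgrp_zero[OF G] by blast
next
  case (insert q S)
  have "\<exists>w\<in>G. \<forall>p\<in>S. P p w"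
    by (rule insert.IH; (rule insert.prems[OF insertI2]; assumption))
  then obtain w1 where w1: "w1 \<in> G" "\<forall>p\<in>S. P p w1" by blast
  obtain wq where wq: "wq \<in> G" "P q wq" using insert.prems by blast
  have "coprime (\<Prod>S) q"
    using insert.hyps insert.prems(1) by (intro prod_coprime_left primes_coprime) auto
  hence "gcd (\<Prod>S) q = 1" by simp
  then obtain r s where rs: "r * \<Prod>S + s * q = 1" using bezout_int[of "\<Prod>S" q] by auto
  \<comment> \<open>Since \<open>s * q\<close> is 1 modulo \<open>\<Prod>S\<close>, this vector is
    congruent to \<open>wq\<close> modulo \<open>q\<close> and to \<open>w1\<close> modulo
    \<open>\<Prod>S\<close>.\<close>
  define w where "w = wq + of_int q *\<^sub>R (of_int s *\<^sub>R (w1 - wq))"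
  have "w \<in> G" unfolding w_def by (intro subgrp_add subgrp_int_scaleR subgrp_diff G w1 wq)
  moreover have "of_int s *\<^sub>R (w1 - wq) \<in> G" by (intro subgrp_int_scaleR subgrp_diff G w1 wq)
  hence "P q w" unfolding w_def by (rule insert.prems(3)[OF insertI1 wq(1) _ wq(2)])
  moreover have "P p w" if pS: "p \<in> S" for p
  proof -
    obtain c where c: "\<Prod>S = p * c"
      using dvd_prodI[OF insert.hyps(1) pS, of "\<lambda>x. x"] unfolding dvd_def by blast
    have "s * q = 1 - r * (p * c)" using rs c by simp
    hence "real_of_int (s * q) = of_int (1 - r * (p * c))" by (simp only:)
    hence "(of_int q * of_int s :: real) = 1 - of_int p * (of_int r * of_int c)"
      by (simp add: mult_ac)
    hence "w = w1 + of_int p *\<^sub>R (of_int (r * c) *\<^sub>R (wq - w1))"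
      by (simp add: w_def scaleR_diff_right scaleR_diff_left)
    moreover have "of_int (r * c) *\<^sub>R (wq - w1) \<in> G"
      by (intro subgrp_int_scaleR subgrp_diff G w1 wq)
    ultimately show ?thesis
      using insert.prems(3)[OF insertI2[OF pS] w1(1)] bspec[OF w1(2) pS] by (simp only:)
  qed
  ultimately show ?case by blast
qed

text \<open>Every element is a multiple of the least positive one, and a prime divisor of the latter
  would divide all of \<open>J\<close>.\<close>

lemma one_in_int_subgrp:
  fixes J :: "int set"
  assumes J: "subgrp J" and np: "\<And>p. prime p \<Longrightarrow> \<exists>j\<in>J. \<not> p dvd j"
  shows "1 \<in> J"
proof -
  have mult: "k * j \<in> J" if "j \<in> J" for j k
  proof -
    have "int i * j \<in> J" for i
      by (induction i) (auto simp: algebra_simps subgrp_zero[OF J] subgrp_add[OF J] that)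
    from this[of "nat k"] subgrp_minus[OF J this[of "nat (-k)"]] show ?thesis
      by (cases "k \<ge> 0") auto
  qed
  \<comment> \<open>The hypothesis at the prime 2 yields an odd, hence nonzero, element, so a least
    positive one exists.\<close>
  obtain j where j: "j \<in> J" "j \<noteq> 0" using np[of 2] by fastforce
  hence "nat \<bar>j\<bar> > 0 \<and> int (nat \<bar>j\<bar>) \<in> J" using subgrp_minus[OF J] by (auto simp: abs_if)
  hence ex: "\<exists>d. d > 0 \<and> int d \<in> J" by blast
  define d where "d = (LEAST d. d > 0 \<and> int d \<in> J)"
  have d: "d > 0" "int d \<in> J" using LeastI_ex[OF ex] by (auto simp: d_def)
  have dvd: "int d dvd i" if "i \<in> J" for i
  proof -
    have "i mod int d = i - (i div int d) * int d" by (simp add: minus_div_mult_eq_mod)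
    also have "\<dots> \<in> J" by (intro subgrp_diff J that mult d)
    finally have "int (nat (i mod int d)) \<in> J" using d by simp
    hence "\<not> (0 < nat (i mod int d) \<and> nat (i mod int d) < d)"
      using not_less_Least[of _ "\<lambda>d. d > 0 \<and> int d \<in> J"]
      unfolding d_def by blast
    moreover have "i mod int d < int d" "i mod int d \<ge> 0" using d by auto
    ultimately have "i mod int d = 0" by linarith
    thus ?thesis by auto
  qed
  have "d = 1"
  proof (rule ccontr)
    assume "d \<noteq> 1"
    then obtain p where "prime p" "p dvd d" using prime_factor_nat by blast
    hence "prime (int p)" "int p dvd int d" by auto
    thus False using np dvd dvd_trans by blast
  qed
  thus ?thesis using d by simp
qed

lemma finite_int_prime_divisors: "m \<noteq> 0 \<Longrightarrow> finite {p::int. prime p \<and> p dvd m}"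
  by (rule finite_subset[of _ "{d. d dvd m}"]) auto

section \<open>The product lattice and its enlargement by z\<close>

definition prod_lat :: "complex \<Rightarrow> complex \<Rightarrow> complex set" where
  "prod_lat \<tau>1 \<tau>2 = {x + \<tau>1 * y | x y. x \<in> lat \<tau>2 \<and> y \<in> lat \<tau>2}"

lemma prod_latI: "x \<in> lat \<tau>2 \<Longrightarrow> y \<in> lat \<tau>2 \<Longrightarrow> x + \<tau>1 * y \<in> prod_lat \<tau>1 \<tau>2"
  by (auto simp: prod_lat_def)

lemma subgrp_prod_lat: "subgrp (prod_lat \<tau>1 \<tau>2)"
  unfolding subgrp_def
proof (intro conjI ballI)
  show "0 \<in> prod_lat \<tau>1 \<tau>2" using prod_latI[of 0 \<tau>2 0 \<tau>1] subgrp_zero[OF subgrp_lat] by simp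
  fix u v assume "u \<in> prod_lat \<tau>1 \<tau>2" "v \<in> prod_lat \<tau>1 \<tau>2"
  then obtain x y x' y' where *: "u = x + \<tau>1 * y" "v = x' + \<tau>1 * y'" "x \<in> lat \<tau>2" "y \<in> lat \<tau>2"
    "x' \<in> lat \<tau>2" "y' \<in> lat \<tau>2" by (auto simp: prod_lat_def)
  have "u - v = (x - x') + \<tau>1 * (y - y')" by (simp add: * algebra_simps)
  also have "\<dots> \<in> prod_lat \<tau>1 \<tau>2" by (intro prod_latI subgrp_diff subgrp_lat *)
  finally show "u - v \<in> prod_lat \<tau>1 \<tau>2" .
qed

lemma mult_in_prod_lat: "l \<in> lat \<tau>1 \<Longrightarrow> y \<in> lat \<tau>2 \<Longrightarrow> l * y \<in> prod_lat \<tau>1 \<tau>2"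
proof -
  assume l: "l \<in> lat \<tau>1" and y: "y \<in> lat \<tau>2"
  obtain a b where "l = of_int a + of_int b * \<tau>1" using l by (auto simp: lat_def)
  hence "l * y = of_int a * y + \<tau>1 * (of_int b * y)" by (simp add: algebra_simps)
  also have "\<dots> \<in> prod_lat \<tau>1 \<tau>2" by (intro prod_latI subgrp_int_mult subgrp_lat y)
  finally show ?thesis .
qed

text \<open>As \<open>lat \<tau>1\<close> is spanned by 1 and \<open>\<tau>1\<close>, every sum of
  products collapses to a single \<open>x + \<tau>1 * y\<close>. This closed form replaces finite
  sums in all later computations.\<close>

lemma prod_lattice_eq_prod_lat: "prod_lattice (lat \<tau>1) (lat \<tau>2) = prod_lat \<tau>1 \<tau>2"
  unfolding prod_lattice_def
proof (rule zspan_eqI[OF subgrp_prod_lat])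
  show "{x * y | x y. x \<in> lat \<tau>1 \<and> y \<in> lat \<tau>2} \<subseteq> prod_lat \<tau>1 \<tau>2"
    using mult_in_prod_lat by blast
  show "prod_lat \<tau>1 \<tau>2 \<subseteq> zspan {x * y | x y. x \<in> lat \<tau>1 \<and> y \<in> lat \<tau>2}" (is "_ \<subseteq> zspan ?S")
  proof
    fix v assume "v \<in> prod_lat \<tau>1 \<tau>2"
    then obtain x y where v: "v = 1 * x + \<tau>1 * y" "x \<in> lat \<tau>2" "y \<in> lat \<tau>2"
      by (auto simp: prod_lat_def)
    have "1 * x \<in> zspan ?S" by (rule set_mp[OF zspan_superset]) (use v one_in_lat in blast)
    moreover have "\<tau>1 * y \<in> zspan ?S"
      by (rule set_mp[OF zspan_superset]) (use v gen_in_lat in blast)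
    ultimately show "v \<in> zspan ?S" unfolding v(1) by (rule subgrp_add[OF subgrp_zspan])
  qed
qed

text \<open>The plane modulo this lattice is the torus of \<open>prod_lat \<tau>1 \<tau>2\<close>
  divided by the subgroup that the image of \<open>z\<close> generates.\<close>

lemma zspan_insert_prod_lat:
  "zspan (insert z (prod_lat \<tau>1 \<tau>2)) = {m + of_int k * z | m k. m \<in> prod_lat \<tau>1 \<tau>2}" (is "_ = ?M")
proof (rule zspan_eqI)
  show "subgrp ?M" unfolding subgrp_def
  proof (intro conjI ballI)
    have "0 = 0 + of_int 0 * z" by simp
    thus "0 \<in> ?M" using subgrp_zero[OF subgrp_prod_lat] by blast
    fix x y assume "x \<in> ?M" "y \<in> ?M"
    then obtain m k m' k' where *: "x = m + of_int k * z" "y = m' + of_int k' * z"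
        "m \<in> prod_lat \<tau>1 \<tau>2" "m' \<in> prod_lat \<tau>1 \<tau>2"
      by auto
    have "x - y = (m - m') + of_int (k - k') * z" by (simp add: * algebra_simps)
    thus "x - y \<in> ?M" using subgrp_diff[OF subgrp_prod_lat *(3,4)] by blast
  qed
  have "z = 0 + of_int 1 * z" by simp
  hence "z \<in> ?M" using subgrp_zero[OF subgrp_prod_lat] by blast
  moreover have "x \<in> ?M" if "x \<in> prod_lat \<tau>1 \<tau>2" for x
  proof -
    have "x = x + of_int 0 * z" by simp
    thus ?thesis using that by blast
  qed
  ultimately show "insert z (prod_lat \<tau>1 \<tau>2) \<subseteq> ?M" by blast
  show "?M \<subseteq> zspan (insert z (prod_lat \<tau>1 \<tau>2))"
  proof
    fix x assume "x \<in> ?M"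
    then obtain m k where x: "x = m + of_int k * z" "m \<in> prod_lat \<tau>1 \<tau>2" by auto
    have "m \<in> zspan (insert z (prod_lat \<tau>1 \<tau>2))" "z \<in> zspan (insert z (prod_lat \<tau>1 \<tau>2))"
      by (rule set_mp[OF zspan_superset], simp add: x(2))+
    thus "x \<in> zspan (insert z (prod_lat \<tau>1 \<tau>2))" unfolding x(1)
      by (intro subgrp_add subgrp_int_mult subgrp_zspan)
  qed
qed

section \<open>The multiplier ring of the extension lattice\<close>

definition cscale :: "complex \<Rightarrow> complex \<times> complex \<Rightarrow> complex \<times> complex" where
  "cscale \<alpha> w = (\<alpha> * fst w, \<alpha> * snd w)"

lemma cscale_simps [simp]: "fst (cscale \<alpha> w) = \<alpha> * fst w" "snd (cscale \<alpha> w) = \<alpha> * snd w"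
  by (simp_all add: cscale_def)

text \<open>Multiplying \<open>A\<close> and \<open>A * \<tau> + B\<close> into the lattice and
  adding produces \<open>A\<close>, \<open>B = (A * \<tau> + B) - A * \<tau>\<close> and
  \<open>C = - (A * \<tau> + B) * \<tau>\<close>, which have a Bezout relation.\<close>

lemma primitive_ideal_invertible:
  assumes "gcd A (gcd B C) = 1" "of_int A * \<tau>\<^sup>2 + of_int B * \<tau> + of_int C = 0"
  obtains l l' where "l \<in> lat \<tau>" "l' \<in> lat \<tau>" "of_int A * l + (of_int A * \<tau> + of_int B) * l' = 1"
proof -
  obtain x y w where xyw: "x * A + y * B + w * C = 1" using primitive_bezout[OF assms(1)] .
  have "of_int (x * A + y * B + w * C) = (1 :: complex)" by (simp only: xyw of_int_1)
  hence xyw': "of_int x * of_int A + of_int y * of_int B + of_int w * of_int C = (1 :: complex)"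
    by simp
  show ?thesis
  proof (rule that)
    show "of_int x + of_int (- y) * \<tau> \<in> lat \<tau>" "of_int y + of_int (- w) * \<tau> \<in> lat \<tau>"
      by (simp_all only: latI)
    show "of_int A * (of_int x + of_int (- y) * \<tau>) + (of_int A * \<tau> + of_int B) * (of_int y + of_int (- w) * \<tau>) = 1"
      unfolding of_int_minus using xyw' assms(2) by algebra
  qed
qed

text \<open>The conductors are \<open>g * m2\<close> for \<open>\<tau>1\<close> and
  \<open>g * m1\<close> for \<open>\<tau>2\<close>, so \<open>g\<close> is their greatest common
  divisor and \<open>g * m1 * m2\<close> their least common multiple. The assumptions
  \<open>f1\<close> and \<open>f2\<close> say that a conductor times \<open>\<omega>\<close>
  generates the respective multiplier ring; \<open>nz\<close> and \<open>ord\<close> fix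
  \<open>n\<close> as the exact order of \<open>z\<close>.\<close>

locale cm_extension =
  fixes \<omega> \<tau>1 \<tau>2 z :: complex and T N A1 B1 C1 k1 A2 B2 C2 k2 g m1 m2 n :: int
  assumes Im_omega: "Im \<omega> \<noteq> 0" and omega_sq: "\<omega>\<^sup>2 = of_int T * \<omega> - of_int N"
    and Im1: "Im \<tau>1 \<noteq> 0" and Im2: "Im \<tau>2 \<noteq> 0"
    and prim1: "gcd A1 (gcd B1 C1) = 1" and eq1: "of_int A1 * \<tau>1\<^sup>2 + of_int B1 * \<tau>1 + of_int C1 = 0"
    and prim2: "gcd A2 (gcd B2 C2) = 1" and eq2: "of_int A2 * \<tau>2\<^sup>2 + of_int B2 * \<tau>2 + of_int C2 = 0"
    and f1: "of_int (g * m2) * \<omega> = of_int A1 * \<tau>1 + of_int k1"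
    and f2: "of_int (g * m1) * \<omega> = of_int A2 * \<tau>2 + of_int k2"
    and pos: "g > 0" "m1 > 0" "m2 > 0" "n > 0" and cop: "coprime m1 m2"
    and nz: "of_int n * z \<in> prod_lat \<tau>1 \<tau>2"
    and ord: "\<And>k. 0 < k \<Longrightarrow> k < n \<Longrightarrow> of_int k * z \<notin> prod_lat \<tau>1 \<tau>2"
begin

abbreviation "PL \<equiv> prod_lat \<tau>1 \<tau>2"
text \<open>When \<open>\<omega>\<close> generates the maximal order, \<open>lat \<phi>\<close> is
  the order whose conductor is the least common multiple, and \<open>lat \<theta>\<close> has index
  \<open>n\<close> in it.\<close>

definition "\<phi> = of_int (g * m1 * m2) * \<omega>"
definition "\<theta> = of_int n * \<phi>"
definition "Lam = {(of_int a * z + y, of_int a * \<tau>1 + of_int b) | a b y. y \<in> lat \<tau>2}"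

lemma f2_lat2: "y \<in> lat \<tau>2 \<Longrightarrow> of_int (g * m1) * \<omega> * y \<in> lat \<tau>2"
proof -
  assume y: "y \<in> lat \<tau>2"
  have "of_int (g * m1) * \<omega> = of_int k2 + of_int 1 * (of_int A2 * \<tau>2)" unfolding f2 by simp
  hence "of_int (g * m1) * \<omega> \<in> lat (of_int A2 * \<tau>2)" by (simp only: latI)
  thus ?thesis using lat_multiplier_iff[OF Im2 prim2 eq2] y by blast
qed

lemma phi_eq1: "\<phi> = of_int m1 * (of_int A1 * \<tau>1 + of_int k1)"
  unfolding f1[symmetric] by (simp add: \<phi>_def)

lemma phi_lat2: "y \<in> lat \<tau>2 \<Longrightarrow> \<phi> * y \<in> lat \<tau>2"
proof -
  assume "y \<in> lat \<tau>2"
  hence "of_int m2 * (of_int (g * m1) * \<omega> * y) \<in> lat \<tau>2"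
    by (intro subgrp_int_mult subgrp_lat f2_lat2)
  thus ?thesis by (simp add: \<phi>_def mult_ac)
qed

text \<open>A multiplier of either factor is one of the product, so \<open>g * m1 * \<omega>\<close>
  and \<open>g * m2 * \<omega>\<close> both act; \<open>m1\<close> and \<open>m2\<close> being
  coprime, \<open>g * \<omega>\<close> is an integral combination of them.\<close>

lemma g_omega_PL: assumes "v \<in> PL" shows "of_int g * \<omega> * v \<in> PL"
proof -
  obtain x y where v: "v = x + \<tau>1 * y" and x: "x \<in> lat \<tau>2" and y: "y \<in> lat \<tau>2"
    using assms by (auto simp: prod_lat_def)
  have "of_int (g * m1) * \<omega> * v = of_int (g * m1) * \<omega> * x + \<tau>1 * (of_int (g * m1) * \<omega> * y)"
    by (simp add: v algebra_simps)
  also have "\<dots> \<in> PL" by (intro prod_latI f2_lat2 x y)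
  finally have 2: "of_int (g * m1) * \<omega> * v \<in> PL" .
  have "of_int (g * m2) * \<omega> * v = (of_int k1 * x - of_int C1 * y) + \<tau>1 * (of_int A1 * x + of_int (k1 - B1) * y)"
    unfolding f1 v of_int_diff using eq1 by algebra
  also have "\<dots> \<in> PL" by (intro prod_latI subgrp_add subgrp_diff subgrp_int_mult subgrp_lat x y)
  finally have 1: "of_int (g * m2) * \<omega> * v \<in> PL" .
  obtain s t where "s * m1 + t * m2 = 1"
    using bezout_int[of m1 m2] cop by (metis coprime_imp_gcd_eq_1)
  hence "of_int (s * m1 + t * m2) = (1::complex)" by simp
  hence "of_int g * \<omega> * v = of_int s * (of_int (g * m1) * \<omega> * v) + of_int t * (of_int (g * m2) * \<omega> * v)"
    unfolding of_int_mult of_int_add by algebra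
  also have "\<dots> \<in> PL" by (intro subgrp_add subgrp_int_mult subgrp_prod_lat 1 2)
  finally show ?thesis .
qed

lemma order_g_PL: assumes "t \<in> lat (of_int g * \<omega>)" "v \<in> PL" shows "t * v \<in> PL"
proof -
  obtain a b where "t = of_int a + of_int b * (of_int g * \<omega>)" using assms by (auto simp: lat_def)
  hence "t * v = of_int a * v + of_int b * (of_int g * \<omega> * v)" by (simp add: algebra_simps)
  also have "\<dots> \<in> PL" by (intro subgrp_add subgrp_int_mult subgrp_prod_lat g_omega_PL assms)
  finally show ?thesis .
qed

text \<open>Write \<open>m1 * t = a + b * (g * m1 * \<omega>)\<close>. The
  \<open>\<omega>\<close>-coefficient of the second number is \<open>g * m2 * a\<close> plus a
  multiple of \<open>g * m1\<close>, and must itself be a multiple of \<open>g * m1\<close>.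
  Coprimality gives \<open>m1 dvd a\<close>.\<close>

lemma order_g_criterion:
  assumes "of_int m1 * t \<in> lat (of_int (g * m1) * \<omega>)"
    and "of_int (g * m2) * \<omega> * (of_int m1 * t) \<in> lat (of_int (g * m1) * \<omega>)"
  shows "t \<in> lat (of_int g * \<omega>)"
proof -
  obtain a b where ab: "of_int m1 * t = of_int a + of_int b * (of_int (g * m1) * \<omega>)"
    using assms(1) by (auto simp: lat_def)
  obtain c d
      where cd: "of_int (g * m2) * \<omega> * (of_int m1 * t) = of_int c + of_int d * (of_int (g * m1) * \<omega>)"
    using assms(2) by (auto simp: lat_def)
  have "of_int (- (g * m2 * b * g * m1 * N)) + of_int (g * m2 * a + g * m2 * b * g * m1 * T) * \<omega>
     = of_int (g * m2) * \<omega> * (of_int m1 * t)"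
    unfolding ab using omega_sq unfolding of_int_mult of_int_add of_int_minus by algebra
  also have "\<dots> = of_int c + of_int (d * (g * m1)) * \<omega>" unfolding cd by simp
  finally have "g * m2 * a + g * m2 * b * g * m1 * T = d * (g * m1)"
    using int_comb_eq_iff[OF Im_omega] by blast
  hence "g * (m2 * a) = g * (m1 * (d - m2 * b * g * T))" by (simp add: algebra_simps)
  hence "m2 * a = m1 * (d - m2 * b * g * T)" using pos by simp
  hence "m1 dvd m2 * a" by simp
  hence "m1 dvd a" using cop by (simp add: coprime_dvd_mult_right_iff)
  then obtain e where "a = m1 * e" by auto
  hence "of_int m1 * t = of_int m1 * (of_int e + of_int b * (of_int g * \<omega>))"
    using ab by (simp add: algebra_simps)
  hence "t = of_int e + of_int b * (of_int g * \<omega>)" using pos by simp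
  thus ?thesis by (simp only: latI)
qed

text \<open>The products with 1 and \<open>\<tau>2\<close> are \<open>A2\<close>,
  \<open>A2 * \<tau>2\<close>, \<open>A2 * \<tau>2 + B2\<close> and \<open>- C2\<close>, all in the
  multiplier ring of \<open>lat \<tau>2\<close>.\<close>

lemma dual_lat2:
  assumes "y \<in> lat \<tau>2" "\<sigma> = of_int A2 \<or> \<sigma> = of_int A2 * \<tau>2 + of_int B2"
  shows "\<sigma> * y \<in> lat (of_int (g * m1) * \<omega>)"
proof -
  obtain a b where y: "y = of_int a + of_int b * \<tau>2" using assms(1) by (auto simp: lat_def)
  have e: "of_int A2 * \<tau>2 = of_int (g * m1) * \<omega> - of_int k2" unfolding f2 by simp
  have "of_int A2 * y = of_int (a * A2 - b * k2) + of_int b * (of_int (g * m1) * \<omega>)"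
    using e unfolding y of_int_mult of_int_diff by algebra
  moreover have "(of_int A2 * \<tau>2 + of_int B2) * y
      = of_int (a * B2 - a * k2 - b * C2) + of_int a * (of_int (g * m1) * \<omega>)"
    using e eq2 unfolding y of_int_mult of_int_diff by algebra
  ultimately show ?thesis using assms(2) latI by metis
qed

text \<open>
  The numbers \<open>A\<close> and \<open>A\<tau> + B = - A (cnj \<tau>)\<close> span \<open>A\<close> times the conjugate of \<open>\<int> + \<int>\<tau>\<close>, which inverts that
  lattice over its multiplier ring.
\<close>

lemma in_PL_if_dual:
  assumes 0: "of_int m1 * (of_int A1 * v) \<in> lat \<tau>2"
    and 1: "of_int m1 * ((of_int A1 * \<tau>1 + of_int B1) * v) \<in> lat \<tau>2"
  shows "v \<in> PL"
proof -
  define \<rho> where "\<rho> = (\<lambda>i::bool. if i then of_int A1 * \<tau>1 + of_int B1 else of_int A1)"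
  define \<sigma> where "\<sigma> = (\<lambda>i::bool. if i then of_int A2 * \<tau>2 + of_int B2 else of_int A2)"
  have v: "of_int m1 * (\<rho> i * v) \<in> lat \<tau>2" for i using 0 1 by (simp add: \<rho>_def)
  \<comment> \<open>The span of \<open>\<rho> False\<close> and \<open>\<rho> True\<close> is stable
    under \<open>g * m2 * \<omega>\<close>, so the hypotheses persist after this
    multiplication.\<close>
  have v': "of_int (g * m2) * \<omega> * (of_int m1 * (\<rho> i * v)) \<in> lat \<tau>2" for i
  proof (cases i)
    case False
    have "of_int (g * m2) * \<omega> * (of_int m1 * (\<rho> i * v))
        = of_int A1 * (of_int m1 * (\<rho> True * v)) + of_int (k1 - B1) * (of_int m1 * (\<rho> False * v))"
      unfolding f1 of_int_diff using False by (simp add: \<rho>_def algebra_simps)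
    thus ?thesis using v subgrp_add subgrp_int_mult subgrp_lat by metis
  next
    case True
    have "of_int (g * m2) * \<omega> * (of_int m1 * (\<rho> True * v))
        = of_int (- C1) * (of_int m1 * (\<rho> False * v)) + of_int k1 * (of_int m1 * (\<rho> True * v))"
      unfolding f1 of_int_minus \<rho>_def if_True if_False using eq1 by algebra
    thus ?thesis using v subgrp_add subgrp_int_mult subgrp_lat True by metis
  qed
  have t: "\<rho> i * \<sigma> j * v \<in> lat (of_int g * \<omega>)" for i j
  proof (rule order_g_criterion)
    have \<sigma>: "\<sigma> j = of_int A2 \<or> \<sigma> j = of_int A2 * \<tau>2 + of_int B2" by (simp add: \<sigma>_def)
    show "of_int m1 * (\<rho> i * \<sigma> j * v) \<in> lat (of_int (g * m1) * \<omega>)"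
      using dual_lat2[OF v[of i] \<sigma>] by (simp add: mult_ac)
    show "of_int (g * m2) * \<omega> * (of_int m1 * (\<rho> i * \<sigma> j * v)) \<in> lat (of_int (g * m1) * \<omega>)"
      using dual_lat2[OF v'[of i] \<sigma>] by (simp add: mult_ac)
  qed
  obtain l0 l1 where l: "l0 \<in> lat \<tau>1" "l1 \<in> lat \<tau>1" "\<rho> False * l0 + \<rho> True * l1 = 1"
    using primitive_ideal_invertible[OF prim1 eq1] unfolding \<rho>_def if_True if_False by blast
  obtain y0 y1 where y: "y0 \<in> lat \<tau>2" "y1 \<in> lat \<tau>2" "\<sigma> False * y0 + \<sigma> True * y1 = 1"
    using primitive_ideal_invertible[OF prim2 eq2] unfolding \<sigma>_def if_True if_False by blast
  \<comment> \<open>Inserting both inversion relations writes \<open>v\<close> as a sum of elements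
    of the order of conductor \<open>g\<close> times products from the two lattices.\<close>
  have "v = (\<rho> False * l0 + \<rho> True * l1) * (\<sigma> False * y0 + \<sigma> True * y1) * v" by (simp add: l y)
  also have "\<dots> = \<rho> False * \<sigma> False * v * (l0 * y0) + \<rho> False * \<sigma> True * v * (l0 * y1)
     + (\<rho> True * \<sigma> False * v * (l1 * y0) + \<rho> True * \<sigma> True * v * (l1 * y1))"
    by (simp add: algebra_simps)
  also have "\<dots> \<in> PL" by (intro subgrp_add subgrp_prod_lat order_g_PL t mult_in_prod_lat l y)
  finally show ?thesis .
qed

lemma n_dvd_if_in_PL: assumes "of_int r * z \<in> PL" shows "n dvd r"
proof -
  have "of_int (r mod n) * z = of_int r * z - of_int (r div n) * (of_int n * z)"
    unfolding minus_div_mult_eq_mod[symmetric] by (simp add: algebra_simps)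
  also have "\<dots> \<in> PL" by (intro subgrp_diff subgrp_prod_lat subgrp_int_mult nz assms)
  finally have "\<not> (0 < r mod n \<and> r mod n < n)" using ord[of "r mod n"] by blast
  hence "r mod n = 0" using pos(4) pos_mod_bound[of n r] pos_mod_sign[of n r] by linarith
  thus ?thesis by auto
qed

lemma Lam_iff: "(u, of_int a * \<tau>1 + of_int b) \<in> Lam \<longleftrightarrow> u - of_int a * z \<in> lat \<tau>2"
proof
  assume "(u, of_int a * \<tau>1 + of_int b) \<in> Lam"
  then obtain a' b' y where *: "u = of_int a' * z + y"
      "of_int a * \<tau>1 + of_int b = of_int a' * \<tau>1 + of_int b'"
    "y \<in> lat \<tau>2" by (auto simp: Lam_def)
  hence "a = a'" using int_comb_eq_iff[OF Im1, of b a b' a'] by (simp add: add.commute)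
  thus "u - of_int a * z \<in> lat \<tau>2" using * by simp
next
  assume "u - of_int a * z \<in> lat \<tau>2"
  moreover have "u = of_int a * z + (u - of_int a * z)" by simp
  ultimately show "(u, of_int a * \<tau>1 + of_int b) \<in> Lam" unfolding Lam_def by blast
qed

lemma Lam_cases:
  assumes "w \<in> Lam"
  obtains u a b where "w = (u, of_int a * \<tau>1 + of_int b)" "u - of_int a * z \<in> lat \<tau>2"
  using assms by (fastforce simp: Lam_def)

lemma Lam_snd: "(u, v) \<in> Lam \<Longrightarrow> v \<in> lat \<tau>1"
  by (erule Lam_cases) (auto simp: lat_def add.commute)

lemma Lam_zero_iff: "(u, 0) \<in> Lam \<longleftrightarrow> u \<in> lat \<tau>2"
  using Lam_iff[of u 0 0] by simp

lemma subgrp_Lam: "subgrp Lam"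
  unfolding subgrp_def
proof (intro conjI ballI)
  show "0 \<in> Lam" using Lam_zero_iff[of 0] subgrp_zero[OF subgrp_lat] by (simp add: zero_prod_def)
  fix w w' assume "w \<in> Lam" "w' \<in> Lam"
  then obtain u a b u' a' b' where *: "w = (u, of_int a * \<tau>1 + of_int b)"
      "u - of_int a * z \<in> lat \<tau>2"
     "w' = (u', of_int a' * \<tau>1 + of_int b')" "u' - of_int a' * z \<in> lat \<tau>2"
    by (elim Lam_cases)
  have "w - w' = (u - u', of_int (a - a') * \<tau>1 + of_int (b - b'))" by (simp add: * algebra_simps)
  moreover have "(u - of_int a * z) - (u' - of_int a' * z) \<in> lat \<tau>2"
    by (intro subgrp_diff subgrp_lat *)
  hence "u - u' - of_int (a - a') * z \<in> lat \<tau>2" by (simp add: algebra_simps)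
  ultimately show "w - w' \<in> Lam" by (simp only: Lam_iff)
qed

text \<open>\<open>\<phi>\<close> acts on both \<open>lat \<tau>1\<close> and
  \<open>lat \<tau>2\<close>; the obstruction to acting on \<open>Lam\<close> is a multiple of
  \<open>z\<close>, and the factor \<open>n\<close> turns that \<open>z\<close> into
  \<open>n * z\<close>, an element of \<open>PL\<close>.\<close>

lemma theta_Lam: assumes "w \<in> Lam" shows "cscale \<theta> w \<in> Lam"
proof -
  obtain u a b where w: "w = (u, of_int a * \<tau>1 + of_int b)" "u - of_int a * z \<in> lat \<tau>2"
    using assms by (elim Lam_cases)
  define y where "y = u - of_int a * z"
  have y: "y \<in> lat \<tau>2" "u = of_int a * z + y" using w by (auto simp: y_def)
  obtain x0 x1 where x: "of_int n * z = x0 + \<tau>1 * x1" "x0 \<in> lat \<tau>2" "x1 \<in> lat \<tau>2"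
    using nz by (auto simp: prod_lat_def)
  \<comment> \<open>These are the coordinates in
    \<open>\<phi> * (a * \<tau>1 + b) = c * \<tau>1 + d\<close>. Hence
    \<open>(a * \<phi> - c) * \<tau>1 = d - b * \<phi>\<close>, which sends
    \<open>lat \<tau>2\<close> into itself.\<close>
  define c where "c = a * m1 * (k1 - B1) + b * m1 * A1"
  define d where "d = b * m1 * k1 - a * m1 * C1"
  have "\<theta> * (of_int a * \<tau>1 + of_int b) = of_int (n * c) * \<tau>1 + of_int (n * d)"
    unfolding \<theta>_def phi_eq1 c_def d_def of_int_mult of_int_add of_int_diff using eq1 by algebra
  moreover have "\<theta> * u - of_int (n * c) * z = of_int n * (\<phi> * y)
      + (of_int a * (\<phi> * x0) - of_int c * x0)
      + (of_int (- (a * m1 * C1) + b * m1 * k1) * x1 - of_int b * (\<phi> * x1))"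
  proof -
    have "\<theta> * u - of_int (n * c) * z = of_int n * (\<phi> * y) + (of_int a * \<phi> - of_int c) * (of_int n * z)"
      by (simp add: \<theta>_def y(2) algebra_simps)
    also have "(of_int a * \<phi> - of_int c) * (of_int n * z) = (of_int a * (\<phi> * x0) - of_int c * x0)
      + (of_int (- (a * m1 * C1) + b * m1 * k1) * x1 - of_int b * (\<phi> * x1))"
      unfolding x(1) phi_eq1 c_def of_int_mult of_int_add of_int_diff of_int_minus
        using eq1 by algebra
    finally show ?thesis by (simp only: add.assoc)
  qed
  moreover have "\<dots> \<in> lat \<tau>2"
    by (intro subgrp_add subgrp_diff subgrp_int_mult subgrp_lat phi_lat2 y x)
  ultimately show ?thesis by (simp only: w(1) cscale_def fst_conv snd_conv Lam_iff)
qed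

text \<open>Such an \<open>\<alpha>\<close> multiplies both the sublattice
  \<open>lat \<tau>2\<close> and the quotient \<open>lat \<tau>1\<close>, so it lies in the
  intersection of their orders and is an integer plus \<open>r * \<phi>\<close>. The gluing by
  \<open>z\<close> then forces \<open>r * z\<close> into \<open>PL\<close>, whence
  \<open>n dvd r\<close>.\<close>

lemma Lam_multiplier:
  assumes y: "\<And>y. y \<in> lat \<tau>2 \<Longrightarrow> (\<alpha> * y, 0) \<in> Lam" and "(0, \<alpha>) \<in> Lam" and "(\<alpha> * z, \<alpha> * \<tau>1) \<in> Lam"
  shows "\<alpha> \<in> lat \<theta>"
proof -
  have "\<alpha> \<in> lat (of_int A2 * \<tau>2)" using y Lam_zero_iff lat_multiplier_iff[OF Im2 prim2 eq2] by blast
  then obtain s2 r2 where \<alpha>2: "\<alpha> = of_int s2 + of_int r2 * (of_int A2 * \<tau>2)" by (auto simp: lat_def)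
  have "\<alpha> \<in> lat \<tau>1" "\<alpha> * \<tau>1 \<in> lat \<tau>1" using assms(2,3) Lam_snd by blast+
  have "\<alpha> \<in> lat (of_int A1 * \<tau>1)"
  proof (subst lat_multiplier_iff[OF Im1 prim1 eq1, symmetric], intro ballI)
    fix x assume "x \<in> lat \<tau>1"
    then obtain a b where "x = of_int a + of_int b * \<tau>1" by (auto simp: lat_def)
    hence "\<alpha> * x = of_int a * \<alpha> + of_int b * (\<alpha> * \<tau>1)" by (simp add: algebra_simps)
    also have "\<dots> \<in> lat \<tau>1"
      by (intro subgrp_add subgrp_int_mult subgrp_lat \<open>\<alpha> \<in> lat \<tau>1\<close> \<open>\<alpha> * \<tau>1 \<in> lat \<tau>1\<close>)
    finally show "\<alpha> * x \<in> lat \<tau>1" .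
  qed
  then obtain s1 r1 where \<alpha>1: "\<alpha> = of_int s1 + of_int r1 * (of_int A1 * \<tau>1)" by (auto simp: lat_def)
  have "of_int (s1 - r1 * k1) + of_int (r1 * (g * m2)) * \<omega> = of_int (s2 - r2 * k2) + of_int (r2 * (g * m1)) * \<omega>"
    using \<alpha>1 \<alpha>2 f1 f2 unfolding of_int_mult of_int_diff by algebra
  hence "r1 * (g * m2) = r2 * (g * m1)" using int_comb_eq_iff[OF Im_omega] by blast
  hence r12: "r1 * m2 = r2 * m1" using pos(1) by simp
  hence "m1 dvd r1 * m2" by simp
  hence "m1 dvd r1" using cop by (simp add: coprime_dvd_mult_left_iff)
  then obtain r where r: "r1 = m1 * r" by auto
  \<comment> \<open>The memberships of \<open>(0, \<alpha>)\<close> and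
    \<open>(\<alpha> * z, \<alpha> * \<tau>1)\<close> are precisely the two conditions of the
    duality criterion for \<open>r * z\<close>.\<close>
  have "of_int r * z \<in> PL"
  proof (rule in_PL_if_dual)
    have "(0, of_int (r * m1 * A1) * \<tau>1 + of_int s1) \<in> Lam"
      using assms(2) by (simp add: \<alpha>1 r mult_ac add_ac)
    hence "0 - of_int (r * m1 * A1) * z \<in> lat \<tau>2" by (simp only: Lam_iff)
    hence "- (0 - of_int (r * m1 * A1) * z) \<in> lat \<tau>2" by (intro subgrp_minus subgrp_lat)
    thus "of_int m1 * (of_int A1 * (of_int r * z)) \<in> lat \<tau>2" by (simp add: mult_ac)
    have "\<alpha> * \<tau>1 = of_int (s1 - r * m1 * B1) * \<tau>1 + of_int (- (r * m1 * C1))"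
      unfolding \<alpha>1 r of_int_mult of_int_diff of_int_minus using eq1 by algebra
    hence "(\<alpha> * z, of_int (s1 - r * m1 * B1) * \<tau>1 + of_int (- (r * m1 * C1))) \<in> Lam"
      using assms(3) by simp
    hence "\<alpha> * z - of_int (s1 - r * m1 * B1) * z \<in> lat \<tau>2" by (simp only: Lam_iff)
    thus "of_int m1 * ((of_int A1 * \<tau>1 + of_int B1) * (of_int r * z)) \<in> lat \<tau>2"
      by (simp add: \<alpha>1 r algebra_simps)
  qed
  hence "n dvd r" by (rule n_dvd_if_in_PL)
  then obtain e where "r = n * e" by auto
  hence "\<alpha> = of_int (s1 - e * n * m1 * k1) + of_int e * \<theta>"
    unfolding \<theta>_def phi_eq1 by (simp add: \<alpha>1 r algebra_simps)
  thus ?thesis by (simp only: latI)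
qed

section \<open>A lattice vector that is no eigenvector modulo any prime\<close>

text \<open>\<open>eig p a w\<close> says that \<open>\<theta>w \<equiv> aw\<close> modulo \<open>p\<Lambda>\<close>.\<close>

definition eig :: "int \<Rightarrow> int \<Rightarrow> complex \<times> complex \<Rightarrow> bool" where
  "eig p a w \<longleftrightarrow> cscale ((\<theta> - of_int a) / of_int p) w \<in> Lam"

text \<open>Vectors in \<open>p\<close> times \<open>Lam\<close> count as bad, so a good vector is
  in particular not divisible by \<open>p\<close>.\<close>

definition bad :: "int \<Rightarrow> complex \<times> complex \<Rightarrow> bool" where
  "bad p w \<longleftrightarrow> (\<exists>a. eig p a w)"

lemma order_Lam: assumes "\<alpha> \<in> lat \<theta>" "w \<in> Lam" shows "cscale \<alpha> w \<in> Lam"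
proof -
  obtain a b where "\<alpha> = of_int a + of_int b * \<theta>" using assms(1) by (auto simp: lat_def)
  hence "cscale \<alpha> w = of_int a *\<^sub>R w + of_int b *\<^sub>R cscale \<theta> w"
    by (simp add: prod_eq_iff scaleR_conv_of_real algebra_simps)
  also have "\<dots> \<in> Lam" by (intro subgrp_add subgrp_int_scaleR subgrp_Lam theta_Lam assms)
  finally show ?thesis .
qed

lemma eig_add: "eig p a w \<Longrightarrow> eig p a w' \<Longrightarrow> eig p a (w + w')"
  and eig_diff: "eig p a w \<Longrightarrow> eig p a w' \<Longrightarrow> eig p a (w - w')"
  and eig_scale: "eig p a w \<Longrightarrow> eig p a (of_int k *\<^sub>R w)"
proof -
  let ?c = "cscale ((\<theta> - of_int a) / of_int p)"
  have "?c (w + w') = ?c w + ?c w'" "?c (w - w') = ?c w - ?c w'"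
      "?c (of_int k *\<^sub>R w) = of_int k *\<^sub>R ?c w"
    by (simp_all add: prod_eq_iff scaleR_conv_of_real ring_distribs)
  thus "eig p a w \<Longrightarrow> eig p a w' \<Longrightarrow> eig p a (w + w')"
    "eig p a w \<Longrightarrow> eig p a w' \<Longrightarrow> eig p a (w - w')"
    "eig p a w \<Longrightarrow> eig p a (of_int k *\<^sub>R w)"
    unfolding eig_def by (simp_all add: subgrp_add subgrp_diff subgrp_int_scaleR subgrp_Lam)
qed

lemma eig_multiple: assumes "p \<noteq> 0" "v \<in> Lam" shows "eig p a (of_int p *\<^sub>R v)"
proof -
  have "cscale ((\<theta> - of_int a) / of_int p) (of_int p *\<^sub>R v) = cscale (of_int (- a) + of_int 1 * \<theta>) v"
    using assms(1) by (simp add: prod_eq_iff scaleR_conv_of_real)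
  thus ?thesis unfolding eig_def using order_Lam[OF latI assms(2)] by metis
qed

lemma eig_cong: assumes "p \<noteq> 0" "p dvd a - b" "w \<in> Lam" "eig p a w" shows "eig p b w"
proof -
  obtain c where "a - b = p * c" using assms(2) by auto
  hence b: "b = a - p * c" by simp
  have "cscale ((\<theta> - of_int b) / of_int p) w = cscale ((\<theta> - of_int a) / of_int p) w + of_int c *\<^sub>R w"
    using assms(1) by (simp add: b prod_eq_iff scaleR_conv_of_real field_simps)
  thus ?thesis
    using assms(3,4) unfolding eig_def by (simp add: subgrp_add subgrp_int_scaleR subgrp_Lam)
qed

text \<open>This is the invariance that \<open>subgrp_crt\<close> asks for.\<close>

lemma bad_shift: assumes "p \<noteq> 0" "v \<in> Lam" shows "bad p (w + of_int p *\<^sub>R v) \<longleftrightarrow> bad p w"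
proof
  assume "bad p (w + of_int p *\<^sub>R v)"
  then obtain a where "eig p a (w + of_int p *\<^sub>R v)" by (auto simp: bad_def)
  from eig_diff[OF this eig_multiple[OF assms]] show "bad p w" by (auto simp: bad_def)
next
  assume "bad p w"
  then obtain a where "eig p a w" by (auto simp: bad_def)
  from eig_add[OF this eig_multiple[OF assms]] show "bad p (w + of_int p *\<^sub>R v)"
    by (auto simp: bad_def)
qed

text \<open>If independent eigenvectors have an eigenvector as sum, comparing coefficients in
  \<open>\<theta> * (e + e')\<close> shows that all eigenvalues agree modulo
  \<open>p\<close>.\<close>

lemma eig_common:
  assumes p: "p \<noteq> 0" and e: "e \<in> Lam" "e' \<in> Lam"
    and indep: "\<And>a b v. v \<in> Lam \<Longrightarrow> of_int a *\<^sub>R e + of_int b *\<^sub>R e' = of_int p *\<^sub>R v \<Longrightarrow> p dvd a \<and> p dvd b"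
    and bad: "bad p e'" "bad p (e + e')" and eig: "eig p a e"
  shows "eig p a e'"
proof -
  obtain a' a'' where a': "eig p a' e'" and a'': "eig p a'' (e + e')"
    using bad by (auto simp: bad_def)
  let ?c = "\<lambda>a. cscale ((\<theta> - of_int a) / of_int p)"
  have "?c a e + ?c a' e' - ?c a'' (e + e') \<in> Lam"
    using a' a'' eig unfolding eig_def by (intro subgrp_add subgrp_diff subgrp_Lam)
  moreover have "of_int (a'' - a) *\<^sub>R e + of_int (a'' - a') *\<^sub>R e' = of_int p *\<^sub>R (?c a e + ?c a' e' - ?c a'' (e + e'))"
    using p by (simp add: prod_eq_iff scaleR_conv_of_real field_simps)
  ultimately have "p dvd a'' - a" "p dvd a'' - a'" using indep by blast+
  hence "p dvd (a'' - a) - (a'' - a')" by (rule dvd_diff)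
  hence "p dvd a' - a" by simp
  thus ?thesis using eig_cong[OF p _ e(2) a'] by blast
qed

lemma Lam_coords_dvd:
  assumes v: "v \<in> Lam"
      and eq: "(of_int c * \<tau>2 + of_int d + of_int a * z, of_int a * \<tau>1 + of_int b) = of_int p *\<^sub>R v"
  shows "p dvd a" "p dvd b" "p dvd c" "p dvd d"
proof -
  obtain u a' b' where w: "v = (u, of_int a' * \<tau>1 + of_int b')" "u - of_int a' * z \<in> lat \<tau>2"
    using v by (elim Lam_cases)
  obtain r s where u: "u - of_int a' * z = of_int r + of_int s * \<tau>2"
    using w(2) by (auto simp: lat_def)
  have "of_int b + of_int a * \<tau>1 = of_int (p * b') + of_int (p * a') * \<tau>1"
    using eq by (simp add: w scaleR_conv_of_real algebra_simps)
  hence ab: "a = p * a'" "b = p * b'" using int_comb_eq_iff[OF Im1] by blast+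
  have "of_int d + of_int c * \<tau>2 = of_int p * (u - of_int a' * z)"
    using eq by (simp add: w scaleR_conv_of_real algebra_simps ab)
  also have "\<dots> = of_int (p * r) + of_int (p * s) * \<tau>2" unfolding u by (simp add: algebra_simps)
  finally have "d = p * r" "c = p * s" using int_comb_eq_iff[OF Im2] by blast+
  thus "p dvd a" "p dvd b" "p dvd c" "p dvd d" using ab by auto
qed

lemma generators_in_Lam: "(\<tau>2, 0) \<in> Lam" "(1, 0) \<in> Lam" "(z, \<tau>1) \<in> Lam" "(0, 1) \<in> Lam"
  using Lam_zero_iff one_in_lat gen_in_lat Lam_iff[of z 1 0] Lam_iff[of 0 0 1] subgrp_zero[OF subgrp_lat, of \<tau>2]
  by auto

lemma theta_eq1: "\<theta> = of_int (n * m1) * (of_int A1 * \<tau>1 + of_int k1)"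
  by (simp add: \<theta>_def phi_eq1)

lemma theta_eq: "\<theta> = of_int (n * g * m1 * m2) * \<omega>"
  by (simp add: \<theta>_def \<phi>_def)

lemma Im_theta: "Im \<theta> \<noteq> 0"
  using Im_omega pos by (simp add: theta_eq)

text \<open>Were every vector an eigenvector modulo \<open>p\<close>, then \<open>\<theta>\<close>
  would be a scalar \<open>a\<close> there, and \<open>(\<theta> - a) / p\<close> would multiply
  \<open>Lam\<close> into itself without lying in \<open>lat \<theta>\<close>.\<close>

lemma exists_good: assumes "prime p" shows "\<exists>w\<in>Lam. \<not> bad p w"
proof (rule ccontr)
  assume "\<not> ?thesis"
  hence bad: "\<And>w. w \<in> Lam \<Longrightarrow> bad p w" by blast
  have p: "p \<noteq> 0" using assms by auto
  obtain a where a: "eig p a (0, 1)" using bad generators_in_Lam by (auto simp: bad_def)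
  \<comment> \<open>Each remaining generator is compared with \<open>(0, 1)\<close>, whose
    eigenvalue is \<open>a\<close>.\<close>
  have step: "eig p a e" if "e \<in> {(\<tau>2, 0), (1, 0), (z, \<tau>1)}" for e
  proof (rule eig_common[OF p _ _ _ _ _ a])
    show e: "e \<in> Lam" "(0, 1) \<in> Lam" using that generators_in_Lam by auto
    show "bad p e" "bad p ((0, 1) + e)" by (intro bad subgrp_add subgrp_Lam e)+
    fix b c v assume v: "v \<in> Lam" "of_int b *\<^sub>R (0, 1) + of_int c *\<^sub>R e = of_int p *\<^sub>R v"
    show "p dvd b \<and> p dvd c"
      using that v(2) Lam_coords_dvd[OF v(1), of c 0 0 b p] Lam_coords_dvd[OF v(1), of 0 c 0 b p]
        Lam_coords_dvd[OF v(1), of 0 0 c b p]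
      by (auto simp: scaleR_conv_of_real add.commute)
  qed
  define \<alpha> where "\<alpha> = (\<theta> - of_int a) / of_int p"
  have "\<alpha> \<in> lat \<theta>"
  proof (rule Lam_multiplier)
    show "(0, \<alpha>) \<in> Lam" "(\<alpha> * z, \<alpha> * \<tau>1) \<in> Lam"
      using a step[of "(z, \<tau>1)"] by (auto simp: eig_def cscale_def \<alpha>_def)
    fix y assume "y \<in> lat \<tau>2"
    then obtain c d where y: "y = of_int c + of_int d * \<tau>2" by (auto simp: lat_def)
    have "eig p a (of_int c *\<^sub>R (1, 0) + of_int d *\<^sub>R (\<tau>2, 0))"
      by (intro eig_add eig_scale step) auto
    thus "(\<alpha> * y, 0) \<in> Lam" by (simp add: eig_def cscale_def \<alpha>_def y scaleR_conv_of_real)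
  qed
  then obtain s r where "\<alpha> = of_int s + of_int r * \<theta>" by (auto simp: lat_def)
  hence "\<theta> - of_int a = of_int p * (of_int s + of_int r * \<theta>)"
    using p by (simp add: \<alpha>_def field_simps)
  hence "of_int (- a) + of_int 1 * \<theta> = of_int (p * s) + of_int (p * r) * \<theta>"
    by (simp add: algebra_simps)
  hence "p * r = 1" using int_comb_eq_iff[OF Im_theta] by metis
  thus False using assms by (metis dvd_triv_left not_prime_unit)
qed

text \<open>\<open>\<tau>1\<close> and its conjugate are the two roots, so \<open>B1\<close> and
  \<open>C1\<close> come from their sum and product. The form is thus nonzero whenever the second
  coordinate is.\<close>

lemma norm_form_eq:
  "(of_int (A1 * b\<^sup>2 - B1 * a * b + C1 * a\<^sup>2) :: complex)
     = of_int A1 * (of_int a * \<tau>1 + of_int b) * cnj (of_int a * \<tau>1 + of_int b)"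
proof -
  let ?t = "cnj \<tau>1"
  have "cnj (of_int A1 * \<tau>1\<^sup>2 + of_int B1 * \<tau>1 + of_int C1) = cnj 0" by (simp only: eq1)
  hence eq': "of_int A1 * ?t\<^sup>2 + of_int B1 * ?t + of_int C1 = 0" by simp
  have "(\<tau>1 - ?t) * (of_int A1 * (\<tau>1 + ?t) + of_int B1) = 0" using eq1 eq' by algebra
  moreover have "\<tau>1 - ?t \<noteq> 0" using Im1 by (simp add: complex_eq_iff)
  ultimately have B: "of_int A1 * (\<tau>1 + ?t) + of_int B1 = 0" by simp
  have C: "of_int C1 = of_int A1 * \<tau>1 * ?t" using B eq1 by algebra
  show ?thesis
    unfolding of_int_mult of_int_add of_int_diff of_int_power complex_cnj_add complex_cnj_mult complex_cnj_of_int
    using B C by algebra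
qed

text \<open>Projecting to \<open>lat \<tau>1\<close>, the second coordinate and its multiple by
  \<open>\<theta>\<close> are dependent modulo \<open>p\<close>. The determinant of their
  coordinates is \<open>n * m1\<close> times the norm form.\<close>

lemma bad_dvd_norm:
  assumes "bad p (u, of_int a * \<tau>1 + of_int b)" "p \<noteq> 0"
  shows "p dvd n * m1 * (A1 * b\<^sup>2 - B1 * a * b + C1 * a\<^sup>2)"
proof -
  let ?x = "of_int a * \<tau>1 + of_int b"
  obtain e where "eig p e (u, ?x)" using assms(1) by (auto simp: bad_def)
  hence "(\<theta> - of_int e) / of_int p * ?x \<in> lat \<tau>1" using Lam_snd by (auto simp: eig_def cscale_def)
  then obtain s r where sr: "(\<theta> - of_int e) / of_int p * ?x = of_int s + of_int r * \<tau>1"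
    by (auto simp: lat_def)
  have "(\<theta> - of_int e) * ?x = of_int p * ((\<theta> - of_int e) / of_int p * ?x)" using assms(2) by simp
  hence "(\<theta> - of_int e) * ?x = of_int p * (of_int s + of_int r * \<tau>1)" by (simp only: sr)
  hence "of_int (n * m1 * (b * k1 - a * C1) - e * b) + of_int (n * m1 * (a * (k1 - B1) + b * A1) - e * a) * \<tau>1
     = of_int (p * s) + of_int (p * r) * \<tau>1"
    unfolding theta_eq1 of_int_mult of_int_add of_int_diff using eq1 by algebra
  hence "n * m1 * (b * k1 - a * C1) - e * b = p * s"
      "n * m1 * (a * (k1 - B1) + b * A1) - e * a = p * r"
    using int_comb_eq_iff[OF Im1] by blast+
  hence "n * m1 * (A1 * b\<^sup>2 - B1 * a * b + C1 * a\<^sup>2) = p * (b * r - a * s)" by algebra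
  thus ?thesis by simp
qed

text \<open>Otherwise \<open>(\<theta> - a) / p\<close> lies in the multiplier ring of
  \<open>lat \<tau>2\<close>, and comparing \<open>\<omega>\<close>-coefficients gives
  \<open>p dvd n * g * m1 * m2\<close>.\<close>

lemma no_eig_lat2:
  assumes "prime p" "\<not> p dvd n * g * m1 * m2" "\<And>y. y \<in> lat \<tau>2 \<Longrightarrow> eig p a (y, 0)"
  shows False
proof -
  have p: "p \<noteq> 0" using assms(1) by auto
  define \<alpha> where "\<alpha> = (\<theta> - of_int a) / of_int p"
  have "\<alpha> * y \<in> lat \<tau>2" if "y \<in> lat \<tau>2" for y
    using assms(3)[OF that] by (simp add: eig_def cscale_def Lam_zero_iff \<alpha>_def)
  hence "\<alpha> \<in> lat (of_int A2 * \<tau>2)" using lat_multiplier_iff[OF Im2 prim2 eq2] by blast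
  then obtain s r where "\<alpha> = of_int s + of_int r * (of_int A2 * \<tau>2)" by (auto simp: lat_def)
  hence "\<theta> - of_int a = of_int p * (of_int s + of_int r * (of_int A2 * \<tau>2))"
    using p by (simp add: \<alpha>_def field_simps)
  hence "\<theta> - of_int a = of_int p * (of_int s + of_int r * (of_int (g * m1) * \<omega> - of_int k2))"
    unfolding f2 by simp
  hence "of_int (- a) + of_int (n * g * m1 * m2) * \<omega> = of_int (p * s - p * r * k2) + of_int (p * r * (g * m1)) * \<omega>"
    unfolding theta_eq by (simp add: algebra_simps)
  hence "n * g * m1 * m2 = p * r * (g * m1)" using int_comb_eq_iff[OF Im_omega] by blast
  thus False using assms(2) by (metis dvd_triv_left mult.assoc)
qed

text \<open>
  Translating by \<open>(y, 0)\<close> keeps the second coordinate, and by \<open>bad_dvd_norm\<close> its norm alone confines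
  the bad primes to a finite set.
\<close>

lemma exists_good_translate:
  assumes p: "prime p" "\<not> p dvd n * g * m1 * m2" and w: "w \<in> Lam"
  shows "\<exists>y\<in>lat \<tau>2. \<not> bad p (w + (y, 0))"
proof (rule ccontr)
  assume "\<not> ?thesis"
  hence bad: "\<And>y. y \<in> lat \<tau>2 \<Longrightarrow> bad p (w + (y, 0))" by blast
  have p0: "p \<noteq> 0" using p(1) by auto
  have y0: "(y, 0) \<in> Lam" if "y \<in> lat \<tau>2" for y using that Lam_zero_iff by simp
  obtain u a b where uab: "w = (u, of_int a * \<tau>1 + of_int b)" "u - of_int a * z \<in> lat \<tau>2"
    using w by (elim Lam_cases)
  show False
  proof (cases "p dvd a \<and> p dvd b")
    case False
    have "bad p w"
      using bad[of 0] subgrp_zero[OF subgrp_lat] by (simp add: zero_prod_def[symmetric])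
    then obtain e where e: "eig p e w" by (auto simp: bad_def)
    have "eig p e (y, 0)" if y: "y \<in> lat \<tau>2" for y
    proof -
      obtain e' where e': "eig p e' (w + (y, 0))" using bad[OF y] by (auto simp: bad_def)
      \<comment> \<open>The second coordinate is nonzero modulo \<open>p\<close> and unchanged by
        the translation, so it determines the eigenvalue: \<open>e'\<close> and \<open>e\<close>
        agree modulo \<open>p\<close>. Subtracting then makes every \<open>(y, 0)\<close> an
        eigenvector for \<open>e\<close>.\<close>
      define t
          where "t = (\<theta> - of_int e) / of_int p * (of_int a * \<tau>1 + of_int b) - (\<theta> - of_int e') / of_int p * (of_int a * \<tau>1 + of_int b)"
      have "t \<in> lat \<tau>1" unfolding t_def
        using e e'
          by (intro subgrp_diff subgrp_lat) (auto simp: eig_def cscale_def uab dest: Lam_snd)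
      moreover have "of_int (e' - e) * (of_int b + of_int a * \<tau>1) = of_int p * t"
        using p0 by (simp add: t_def field_simps)
      ultimately have "p dvd (e' - e) * b" "p dvd (e' - e) * a"
        using lat_coeffs_in_latD[OF Im1] by blast+
      hence "p dvd e' - e" using False p(1) by (auto simp: prime_dvd_mult_iff)
      hence "eig p e (w + (y, 0))"
        using eig_cong[OF p0 _ _ e'] w y0[OF y] by (simp add: subgrp_add subgrp_Lam)
      from eig_diff[OF this e] show ?thesis by simp
    qed
    thus False using no_eig_lat2[OF p] by blast
  next
    case True
    then obtain a' b' where ab: "a = p * a'" "b = p * b'" unfolding dvd_def by blast
    define v where "v = (of_int a' * z, of_int a' * \<tau>1 + of_int b')"
    have v: "v \<in> Lam" unfolding v_def Lam_iff using subgrp_zero[OF subgrp_lat] by simp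
    have all_bad: "bad p (y, 0)" if y: "y \<in> lat \<tau>2" for y
    proof -
      \<comment> \<open>Here \<open>w\<close> is congruent to \<open>(u - a * z, 0)\<close> modulo
        \<open>p\<close>, so its translates cover all of \<open>lat \<tau>2\<close> modulo
        \<open>p\<close>.\<close>
      have "w + (y - (u - of_int a * z), 0) = (y, 0) + of_int p *\<^sub>R v"
        by (simp add: uab v_def ab scaleR_conv_of_real algebra_simps)
      moreover have "bad p (w + (y - (u - of_int a * z), 0))"
        by (intro bad subgrp_diff subgrp_lat y uab)
      ultimately show ?thesis using bad_shift[OF p0 v] by metis
    qed
    obtain e where e: "eig p e (1, 0)" using all_bad one_in_lat by (auto simp: bad_def)
    have e': "eig p e (\<tau>2, 0)"
    proof (rule eig_common[OF p0 _ _ _ _ _ e])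
      show "(1, 0) \<in> Lam" "(\<tau>2, 0) \<in> Lam" "bad p (\<tau>2, 0)" "bad p ((1, 0) + (\<tau>2, 0))"
        using generators_in_Lam all_bad one_in_lat gen_in_lat subgrp_add[OF subgrp_lat] by auto
      fix c d v assume v: "v \<in> Lam" "of_int c *\<^sub>R (1, 0) + of_int d *\<^sub>R (\<tau>2, 0) = of_int p *\<^sub>R v"
      thus "p dvd c \<and> p dvd d" using Lam_coords_dvd[OF v(1), of d c 0 0 p]
        by (simp add: scaleR_conv_of_real add.commute)
    qed
    have "eig p e (y, 0)" if y: "y \<in> lat \<tau>2" for y
    proof -
      obtain c d where "y = of_int c + of_int d * \<tau>2" using y by (auto simp: lat_def)
      moreover have "eig p e (of_int c *\<^sub>R (1, 0) + of_int d *\<^sub>R (\<tau>2, 0))"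
        by (intro eig_add eig_scale e e')
      ultimately show ?thesis by (simp add: scaleR_conv_of_real)
    qed
    thus False using no_eig_lat2[OF p] by blast
  qed
qed

text \<open>Chinese remaindering is applied twice. The first round treats the primes dividing
  \<open>n * g * m1 * m2\<close> and fixes a nonzero second coordinate; afterwards only finitely
  many primes can be bad for any translate by \<open>lat \<tau>2\<close>, and the second round
  treats those.\<close>

lemma exists_everywhere_good: "\<exists>w\<in>Lam. \<forall>p. prime p \<longrightarrow> \<not> bad p w"
proof -
  define S1 where "S1 = {p. prime p \<and> p dvd n * g * m1 * m2}"
  have fin: "finite S1" unfolding S1_def using pos by (intro finite_int_prime_divisors) auto
  have "\<exists>w\<in>Lam. \<forall>p\<in>S1. \<not> bad p w"
  proof (rule subgrp_crt[OF subgrp_Lam fin])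
    fix p assume "p \<in> S1"
    thus p: "prime p" by (simp add: S1_def)
    show "\<exists>w\<in>Lam. \<not> bad p w" by (rule exists_good[OF p])
    fix w v assume "v \<in> Lam" "\<not> bad p w"
    thus "\<not> bad p (w + of_int p *\<^sub>R v)" using bad_shift p by (metis not_prime_0)
  qed
  then obtain w1 where w1: "w1 \<in> Lam" "\<forall>p\<in>S1. \<not> bad p w1" by blast
  have "\<exists>w\<in>Lam. snd w \<noteq> 0 \<and> (\<forall>p\<in>S1. \<not> bad p w)"
  proof (cases "snd w1 = 0")
    case True
    \<comment> \<open>Adding a multiple of every prime in \<open>S1\<close> preserves goodness there
      and makes the second coordinate nonzero.\<close>
    define w where "w = w1 + of_int (\<Prod>S1) *\<^sub>R (0, 1)"
    have "w \<in> Lam"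
      unfolding w_def by (intro subgrp_add subgrp_int_scaleR subgrp_Lam w1 generators_in_Lam)
    moreover have "\<Prod>S1 \<noteq> 0" using fin by (auto simp: S1_def)
    hence "snd w \<noteq> 0" using True by (simp add: w_def del: of_int_prod)
    moreover have "\<not> bad p w" if pS: "p \<in> S1" for p
    proof -
      obtain c where c: "\<Prod>S1 = p * c"
        using dvd_prodI[OF fin pS, of "\<lambda>x. x"] unfolding dvd_def by blast
      have "w = w1 + of_int p *\<^sub>R (of_int c *\<^sub>R (0, 1))" by (simp add: w_def c)
      moreover have "of_int c *\<^sub>R (0, 1) \<in> Lam"
        by (intro subgrp_int_scaleR subgrp_Lam generators_in_Lam)
      ultimately show ?thesis
        using bad_shift[of p] w1(2) that by (metis S1_def mem_Collect_eq not_prime_0)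
    qed
    ultimately show ?thesis by blast
  qed (use w1 in auto)
  then obtain w0 where w0: "w0 \<in> Lam" "snd w0 \<noteq> 0" "\<forall>p\<in>S1. \<not> bad p w0" by blast
  obtain u a b where uab: "w0 = (u, of_int a * \<tau>1 + of_int b)" using w0 by (elim Lam_cases)
  define q where "q = A1 * b\<^sup>2 - B1 * a * b + C1 * a\<^sup>2"
  have "(of_int q :: complex) \<noteq> 0"
    unfolding q_def norm_form_eq
      using w0(2) primitive_lead_nonzero[OF Im1 prim1 eq1]
        by (simp add: uab del: complex_cnj_add complex_cnj_mult)
  hence q0: "q \<noteq> 0" by auto
  \<comment> \<open>For every \<open>y\<close>, all bad primes of \<open>w0 + (y, 0)\<close> divide
    \<open>n * m1 * q\<close>, hence lie in \<open>S\<close>.\<close>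
  define S where "S = {p. prime p \<and> p dvd n * g * m1 * m2 * q}"
  have finS: "finite S" unfolding S_def using pos q0 by (intro finite_int_prime_divisors) auto
  have "\<exists>y\<in>lat \<tau>2. \<forall>p\<in>S. \<not> bad p (w0 + (y, 0))"
  proof (rule subgrp_crt[OF subgrp_lat finS])
    fix p assume p: "p \<in> S"
    show "prime p" using p by (simp add: S_def)
    show "\<exists>y\<in>lat \<tau>2. \<not> bad p (w0 + (y, 0))"
    proof (cases "p \<in> S1")
      case True
      hence "\<not> bad p (w0 + (0, 0))" using w0 by (simp add: zero_prod_def[symmetric])
      thus ?thesis using subgrp_zero[OF subgrp_lat] by blast
    next
      case False
      thus ?thesis using p by (intro exists_good_translate w0) (auto simp: S_def S1_def)
    qed
    fix y y' assume y: "y \<in> lat \<tau>2" "y' \<in> lat \<tau>2" "\<not> bad p (w0 + (y, 0))"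
    have "w0 + (y + of_int p *\<^sub>R y', 0) = w0 + (y, 0) + of_int p *\<^sub>R (y', 0)"
      by (simp add: prod_eq_iff)
    moreover have "(y', 0) \<in> Lam" using y Lam_zero_iff by simp
    ultimately show "\<not> bad p (w0 + (y + of_int p *\<^sub>R y', 0))"
      using bad_shift[of p] y(3) \<open>prime p\<close> by (metis not_prime_0)
  qed
  then obtain y where y: "y \<in> lat \<tau>2" "\<forall>p\<in>S. \<not> bad p (w0 + (y, 0))" by blast
  have "\<not> bad p (w0 + (y, 0))" if p: "prime p" for p
  proof
    assume b: "bad p (w0 + (y, 0))"
    hence "bad p (u + y, of_int a * \<tau>1 + of_int b)" by (simp add: uab)
    hence "p dvd n * m1 * q" unfolding q_def by (rule bad_dvd_norm) (use p in auto)
    hence "p dvd n * m1 * q * (g * m2)" by (rule dvd_mult2)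
    hence "p \<in> S" using p by (simp add: S_def mult_ac)
    thus False using y(2) b by blast
  qed
  moreover have "w0 + (y, 0) \<in> Lam" using y w0 Lam_zero_iff by (intro subgrp_add subgrp_Lam) auto
  ultimately show ?thesis by blast
qed

section \<open>Splitting off a copy of the order\<close>

text \<open>The dual lattice of \<open>Lam\<close>, its integral functionals being extended to
  real-linear ones on the whole space.\<close>

definition dual :: "(complex \<times> complex \<Rightarrow> real) set" where
  "dual = {h. linear h \<and> (\<forall>v\<in>Lam. h v \<in> \<int>)}"

lemma Lam_iff_dual: "v \<in> Lam \<longleftrightarrow> (\<forall>h\<in>dual. h v \<in> \<int>)"
proof
  assume R: "\<forall>h\<in>dual. h v \<in> \<int>"
  \<comment> \<open>\<open>c1\<close>, \<open>c2\<close>, \<open>c3\<close>, \<open>c4\<close> are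
    the real coordinates along \<open>(\<tau>2, 0)\<close>, \<open>(1, 0)\<close>,
    \<open>(z, \<tau>1)\<close>, \<open>(0, 1)\<close>. The second component determines
    \<open>c3\<close>, on which the others depend.\<close>
  define c3 where "c3 = (\<lambda>v::complex \<times> complex. Im (snd v) / Im \<tau>1)"
  define c4 where "c4 = (\<lambda>v. Re (snd v) - c3 v * Re \<tau>1)"
  define c1 where "c1 = (\<lambda>v. Im (fst v - of_real (c3 v) * z) / Im \<tau>2)"
  define c2 where "c2 = (\<lambda>v. Re (fst v - of_real (c3 v) * z) - c1 v * Re \<tau>2)"
  have c3: "linear c3" by (rule linearI) (auto simp: c3_def add_divide_distrib)
  have c4: "linear c4"
    by (rule linearI) (auto simp: c4_def linear_add[OF c3] linear_scale[OF c3] algebra_simps)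
  have c1: "linear c1" using Im2
    by (intro linearI) (auto simp: c1_def linear_add[OF c3] linear_scale[OF c3] field_simps)
  have c2: "linear c2"
    by (rule linearI) (auto simp: c2_def linear_add[OF c3] linear_scale[OF c3] linear_add[OF c1] linear_scale[OF c1] algebra_simps)
  have rep: "v = (of_real (c1 v) * \<tau>2 + of_real (c2 v) + of_real (c3 v) * z, of_real (c3 v) * \<tau>1 + of_real (c4 v))" for v
    using Im1 Im2 by (auto simp: prod_eq_iff complex_eq_iff c1_def c2_def c3_def c4_def)
  have int: "c3 v \<in> \<int>" "c4 v \<in> \<int>" "c1 v \<in> \<int>" "c2 v \<in> \<int>" if vL: "v \<in> Lam" for v
  proof -
    obtain u a b where v: "v = (u, of_int a * \<tau>1 + of_int b)" "u - of_int a * z \<in> lat \<tau>2"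
      using vL by (elim Lam_cases)
    obtain r s where "u - of_int a * z = of_int r + of_int s * \<tau>2"
      using v(2) by (auto simp: lat_def)
    hence u: "u = of_int a * z + of_int r + of_int s * \<tau>2" by (simp add: algebra_simps)
    have 3: "c3 v = of_int a" using Im1 by (simp add: c3_def v)
    have 4: "c4 v = of_int b" by (simp add: c4_def 3) (simp add: v)
    have 1: "c1 v = of_int s" using Im2 by (simp add: c1_def 3) (simp add: v u)
    have 2: "c2 v = of_int r" by (simp add: c2_def 3 1) (simp add: v u)
    show "c3 v \<in> \<int>" "c4 v \<in> \<int>" "c1 v \<in> \<int>" "c2 v \<in> \<int>" by (simp_all add: 1 2 3 4)
  qed
  have "c1 \<in> dual" "c2 \<in> dual" "c3 \<in> dual" "c4 \<in> dual"
    using c1 c2 c3 c4 int by (auto simp: dual_def)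
  hence "c1 v \<in> \<int>" "c2 v \<in> \<int>" "c3 v \<in> \<int>" "c4 v \<in> \<int>" using R by auto
  then obtain r s a b where c: "c1 v = of_int r" "c2 v = of_int s" "c3 v = of_int a"
      "c4 v = of_int b"
    by (elim Ints_cases)
  have "v = (of_int a * z + (of_int s + of_int r * \<tau>2), of_int a * \<tau>1 + of_int b)"
    using rep[of v] unfolding c by (simp add: add_ac)
  moreover have "of_int s + of_int r * \<tau>2 \<in> lat \<tau>2" by (rule latI)
  ultimately show "v \<in> Lam" unfolding Lam_def by blast
qed (simp add: dual_def)

text \<open>The values at \<open>\<theta> * w\<close> of the functionals killing \<open>w\<close>
  form a subgroup \<open>J\<close>. A prime dividing all of \<open>J\<close> would make
  \<open>w\<close> an eigenvector modulo that prime.\<close>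

lemma exists_dual_separating:
  assumes w: "w \<in> Lam" and good: "\<And>p. prime p \<Longrightarrow> \<not> bad p w"
  shows "\<exists>h\<in>dual. h w = 0 \<and> h (cscale \<theta> w) = 1"
proof -
  let ?w' = "cscale \<theta> w"
  have w': "?w' \<in> Lam" by (rule theta_Lam[OF w])
  define J where "J = {j::int. \<exists>h\<in>dual. h w = 0 \<and> h ?w' = of_int j}"
  have comb: "(\<lambda>v. of_int a * h v + of_int b * h' v) \<in> dual" if "h \<in> dual" "h' \<in> dual" for h h' a b
  proof -
    have lin: "linear h" "linear h'" using that by (auto simp: dual_def)
    have "linear (\<lambda>v. of_int a * h v + of_int b * h' v)"
      by (rule linearI) (simp_all add: linear_add[OF lin(1)] linear_add[OF lin(2)]
          linear_scale[OF lin(1)] linear_scale[OF lin(2)] algebra_simps)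
    thus ?thesis using that by (auto simp: dual_def)
  qed
  have "1 \<in> J"
  proof (rule one_in_int_subgrp)
    show "subgrp J" unfolding subgrp_def
    proof (intro conjI ballI)
      have "(\<lambda>_. 0) \<in> dual" by (simp add: dual_def linear_iff)
      thus "0 \<in> J" unfolding J_def by force
      fix i j assume "i \<in> J" "j \<in> J"
      then obtain h h' where h: "h \<in> dual" "h w = 0" "h ?w' = of_int i" "h' \<in> dual" "h' w = 0"
          "h' ?w' = of_int j"
        by (auto simp: J_def)
      have "(\<lambda>v. of_int 1 * h v + of_int (-1) * h' v) \<in> dual" by (rule comb[OF h(1,4)])
      thus "i - j \<in> J" unfolding J_def using h by (intro CollectI bexI) auto
    qed
    fix p :: int assume p: "prime p"
    hence p0: "p \<noteq> 0" by auto
    show "\<exists>j\<in>J. \<not> p dvd j"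
    proof (rule ccontr)
      assume "\<not> ?thesis"
      hence dv: "\<And>j. j \<in> J \<Longrightarrow> p dvd j" by blast
      \<comment> \<open>The combination \<open>h(w) * h' - h'(w) * h\<close> kills \<open>w\<close>,
        and its value at \<open>\<theta> * w\<close> is this minor.\<close>
      have minor: "p dvd c * d' - c' * d"
        if h: "h \<in> dual" "h' \<in> dual" "h w = of_int c" "h ?w' = of_int d" "h' w = of_int c'"
            "h' ?w' = of_int d'"
        for h h' c d c' d'
      proof (rule dv)
        have "(\<lambda>v. of_int (- c') * h v + of_int c * h' v) \<in> dual" by (rule comb[OF h(1,2)])
        thus "c * d' - c' * d \<in> J" unfolding J_def using h
          by (intro CollectI bexI) (auto simp: algebra_simps)
      qed
      have "bad p w"
      proof (cases "\<forall>h\<in>dual. \<forall>c. h w = of_int c \<longrightarrow> p dvd c")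
        case True
        \<comment> \<open>If \<open>p\<close> divides all values at \<open>w\<close>, then
          \<open>w\<close> is divisible by \<open>p\<close> in \<open>Lam\<close>, and 0 serves as
          eigenvalue.\<close>
        have "(1 / of_int p) *\<^sub>R w \<in> Lam" unfolding Lam_iff_dual
        proof
          fix h assume h: "h \<in> dual"
          then obtain c where c: "h w = of_int c" using w by (auto simp: dual_def elim: Ints_cases)
          then obtain c' where c': "c = p * c'" using True h unfolding dvd_def by blast
          have "h ((1 / of_int p) *\<^sub>R w) = (1 / of_int p) * h w"
            using h by (simp add: dual_def linear_scale)
          thus "h ((1 / of_int p) *\<^sub>R w) \<in> \<int>" using p0 by (simp add: c c')
        qed
        from theta_Lam[OF this] have "eig p 0 w"
          by (simp add: eig_def cscale_def scaleR_conv_of_real)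
        thus ?thesis by (auto simp: bad_def)
      next
        case False
        then obtain h c where h: "h \<in> dual" "h w = of_int c" "\<not> p dvd c" by blast
        obtain d where d: "h ?w' = of_int d" using w' h(1) by (auto simp: dual_def elim: Ints_cases)
        have "coprime c p" using p h(3) by (metis prime_imp_coprime coprime_commute)
        hence "gcd c p = 1" by simp
        then obtain s t where st: "s * c + t * p = 1" using bezout_int[of c p] by auto
        \<comment> \<open>The eigenvalue can only be \<open>d / c\<close> modulo \<open>p\<close>,
          and \<open>s\<close> inverts \<open>c\<close>. The vanishing minors show that every other
          functional agrees.\<close>
        have "cscale ((\<theta> - of_int (s * d)) / of_int p) w \<in> Lam" unfolding Lam_iff_dual
        proof
          fix h' assume h': "h' \<in> dual"
          obtain c' where c': "h' w = of_int c'"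
            using w h' by (auto simp: dual_def elim: Ints_cases)
          obtain d' where d': "h' ?w' = of_int d'"
            using w' h' by (auto simp: dual_def elim: Ints_cases)
          obtain e where e: "c * d' - c' * d = p * e"
            using minor[OF h(1) h' h(2) d c' d'] unfolding dvd_def by blast
          have eq: "cscale ((\<theta> - of_int (s * d)) / of_int p) w = (1 / of_int p) *\<^sub>R (?w' - of_int (s * d) *\<^sub>R w)"
            by (simp add: prod_eq_iff scaleR_conv_of_real diff_divide_distrib algebra_simps)
          have lin: "linear h'" using h' by (simp add: dual_def)
          have "h' (cscale ((\<theta> - of_int (s * d)) / of_int p) w) = (1 / of_int p) * (of_int d' - of_int (s * d) * of_int c')"
            unfolding eq by (simp add: linear_scale[OF lin] linear_diff[OF lin] c' d')
          also have "\<dots> = of_int (d' - s * d * c') / of_int p" by simp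
          also have "d' - s * d * c' = p * (s * e + t * d')"
            using e st by algebra
          also have "of_int (p * (s * e + t * d')) / of_int p = (of_int (s * e + t * d') :: real)"
            using p0 by simp
          finally show "h' (cscale ((\<theta> - of_int (s * d)) / of_int p) w) \<in> \<int>" by simp
        qed
        thus ?thesis unfolding bad_def eig_def by (rule exI[of _ "s * d"])
      qed
      thus False using good[OF p] by blast
    qed
  qed
  thus ?thesis by (auto simp: J_def)
qed

lemma theta_sq: "\<theta>\<^sup>2 = of_int (n * g * m1 * m2 * T) * \<theta> - of_int ((n * g * m1 * m2)\<^sup>2 * N)"
  using omega_sq unfolding theta_eq of_int_mult of_int_power by algebra

text \<open>An integral functional \<open>h\<close> extends to a map into
  \<open>lat \<theta>\<close> commuting with \<open>\<theta>\<close>. Its value at \<open>w\<close>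
  is 1 because \<open>h\<close> is 0 at \<open>w\<close> and 1 at
  \<open>\<theta> * w\<close>.\<close>

lemma exists_unimodular:
  obtains p q w1 w2 where "(w1, w2) \<in> Lam" "p * w1 + q * w2 = 1"
    "\<And>u v. (u, v) \<in> Lam \<Longrightarrow> p * u + q * v \<in> lat \<theta>"
proof -
  obtain w where w: "w \<in> Lam" "\<And>p. prime p \<Longrightarrow> \<not> bad p w" using exists_everywhere_good by blast
  obtain h where h: "h \<in> dual" "h w = 0" "h (cscale \<theta> w) = 1"
    using exists_dual_separating[OF w] by blast
  have lin: "linear h" using h(1) by (simp add: dual_def)
  define T' where "T' = n * g * m1 * m2 * T"
  define N' where "N' = (n * g * m1 * m2)\<^sup>2 * N"
  have sq: "\<theta> * \<theta> = of_int T' * \<theta> - of_int N'"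
    using theta_sq by (simp add: T'_def N'_def power2_eq_square)
  \<comment> \<open>the only \<open>\<theta>\<close>-linear map whose \<open>\<theta>\<close>-coordinate is \<open>h\<close>\<close>
  define l
      where "l = (\<lambda>v. of_real (h v) * \<theta> + of_real (h (cscale \<theta> v)) - of_int T' * of_real (h v) :: complex)"
  have add: "l (v + v') = l v + l v'" for v v'
  proof -
    have "cscale \<theta> (v + v') = cscale \<theta> v + cscale \<theta> v'" by (simp add: prod_eq_iff algebra_simps)
    thus ?thesis by (simp add: l_def linear_add[OF lin] algebra_simps)
  qed
  have scale: "l (r *\<^sub>R v) = of_real r * l v" for r v
  proof -
    have "cscale \<theta> (r *\<^sub>R v) = r *\<^sub>R cscale \<theta> v" by (simp add: prod_eq_iff)
    thus ?thesis by (simp add: l_def linear_scale[OF lin] algebra_simps)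
  qed
  have theta: "l (cscale \<theta> v) = \<theta> * l v" for v
  proof -
    have "cscale \<theta> (cscale \<theta> v) = of_int T' *\<^sub>R cscale \<theta> v - of_int N' *\<^sub>R v"
      by (simp add: prod_eq_iff scaleR_conv_of_real mult.assoc[symmetric] sq) (simp add: algebra_simps)
    hence "h (cscale \<theta> (cscale \<theta> v)) = of_int T' * h (cscale \<theta> v) - of_int N' * h v"
      by (simp add: linear_diff[OF lin] linear_scale[OF lin])
    hence "l (cscale \<theta> v) = of_real (h (cscale \<theta> v)) * \<theta> - of_int N' * of_real (h v)"
      by (simp add: l_def)
    also have "\<dots> = \<theta> * l v" unfolding l_def using sq by algebra
    finally show ?thesis .
  qed
  \<comment> \<open>Since 1 and \<open>\<theta>\<close> form a real basis of the complex numbers,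
    real linearity and commuting with \<open>\<theta>\<close> give complex linearity.\<close>
  have cscale: "l (cscale \<alpha> v) = \<alpha> * l v" for \<alpha> v
  proof -
    define s where "s = Im \<alpha> / Im \<theta>"
    define r where "r = Re \<alpha> - s * Re \<theta>"
    have \<alpha>: "\<alpha> = of_real r + of_real s * \<theta>" using Im_theta by (simp add: complex_eq_iff r_def s_def)
    have "cscale \<alpha> v = r *\<^sub>R v + s *\<^sub>R cscale \<theta> v"
      by (simp add: \<alpha> prod_eq_iff scaleR_conv_of_real algebra_simps)
    hence "l (cscale \<alpha> v) = of_real r * l v + of_real s * (\<theta> * l v)" by (simp add: add scale theta)
    thus ?thesis by (simp add: \<alpha> algebra_simps)
  qed
  have l: "l (u, v) = l (1, 0) * u + l (0, 1) * v" for u v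
  proof -
    have "(u, v) = cscale u (1, 0) + cscale v (0, 1)" by (simp add: prod_eq_iff)
    hence "l (u, v) = u * l (1, 0) + v * l (0, 1)" by (simp only: add cscale)
    thus ?thesis by (simp add: mult.commute)
  qed
  show ?thesis
  proof (rule that)
    show "(fst w, snd w) \<in> Lam" using w by simp
    show "l (1, 0) * fst w + l (0, 1) * snd w = 1"
      using h by (simp add: l[symmetric]) (simp add: l_def)
    fix u v assume uv: "(u, v) \<in> Lam"
    obtain a where a: "h (u, v) = of_int a" using uv h(1) by (auto simp: dual_def elim: Ints_cases)
    obtain b where b: "h (cscale \<theta> (u, v)) = of_int b"
      using theta_Lam[OF uv] h(1) by (auto simp: dual_def elim: Ints_cases)
    have "l (u, v) = of_int (b - T' * a) + of_int a * \<theta>" by (simp add: l_def a b)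
    thus "l (1, 0) * u + l (0, 1) * v \<in> lat \<theta>" by (simp only: l[symmetric] latI)
  qed
qed

text \<open>Since \<open>p * w1 + q * w2 = 1\<close>, \<open>Lam\<close> splits into the multiples
  of \<open>(w1, w2)\<close> by \<open>lat \<theta>\<close> and the kernel of the functional. The
  determinant with \<open>(w1, w2)\<close> kills the first summand and identifies the kernel with
  the second factor.\<close>

lemma Lam_tori_iso: "tori_iso Lam (lat \<theta> \<times> {m + of_int k * z | m k. m \<in> PL})"
proof -
  obtain p q w1 w2 where w: "(w1, w2) \<in> Lam" "p * w1 + q * w2 = 1"
    and lam: "\<And>u v. (u, v) \<in> Lam \<Longrightarrow> p * u + q * v \<in> lat \<theta>" by (rule exists_unimodular, rule that)
  let ?M = "{m + of_int k * z | m k. m \<in> PL}"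
  let ?f = "\<lambda>(u, v). (p * u + q * v, - w2 * u + w1 * v)"
  have det: "w1 * v - w2 * u \<in> ?M" if uvL: "(u, v) \<in> Lam" for u v
  proof -
    obtain a b y where uv: "u = of_int a * z + y" "v = of_int a * \<tau>1 + of_int b" "y \<in> lat \<tau>2"
      using uvL by (auto simp: Lam_def)
    obtain a' b' y' where w': "w1 = of_int a' * z + y'" "w2 = of_int a' * \<tau>1 + of_int b'"
        "y' \<in> lat \<tau>2" using w(1) by (auto simp: Lam_def)
    have "v \<in> lat \<tau>1" "w2 \<in> lat \<tau>1" using uvL w(1) Lam_snd by auto
    hence "v * y' - w2 * y \<in> PL" by (intro subgrp_diff subgrp_prod_lat mult_in_prod_lat uv w')
    moreover have "w1 * v - w2 * u = (v * y' - w2 * y) + of_int (a' * b - a * b') * z"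
      by (simp add: uv w' algebra_simps)
    ultimately show ?thesis by blast
  qed
  \<comment> \<open>The image of the kernel. It suffices that all determinants of pairs of lattice
    vectors lie in \<open>D\<close>, since these generate \<open>?M\<close>.\<close>
  define D where "D = {w1 * v - w2 * u | u v. (u, v) \<in> Lam \<and> p * u + q * v = 0}"
  have D: "subgrp D" unfolding subgrp_def
  proof (intro conjI ballI)
    show "0 \<in> D" unfolding D_def using subgrp_zero[OF subgrp_Lam] by (force simp: zero_prod_def)
    fix x y assume "x \<in> D" "y \<in> D"
    then obtain u v u' v' where *: "(u, v) \<in> Lam" "p * u + q * v = 0" "x = w1 * v - w2 * u"
      "(u', v') \<in> Lam" "p * u' + q * v' = 0" "y = w1 * v' - w2 * u'" by (auto simp: D_def)
    have "(u, v) - (u', v') \<in> Lam" by (intro subgrp_diff subgrp_Lam *)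
    moreover have "p * (u - u') + q * (v - v') = 0" using *(2,5) by algebra
    moreover have "x - y = w1 * (v - v') - w2 * (u - u')" by (simp add: * algebra_simps)
    ultimately show "x - y \<in> D" unfolding D_def by auto
  qed
  have det_D: "u * v' - u' * v \<in> D" if uv: "(u, v) \<in> Lam" "(u', v') \<in> Lam" for u v u' v'
  proof -
    let ?a = "p * u + q * v" and ?b = "p * u' + q * v'"
    have "cscale ?a (u', v') - cscale ?b (u, v) \<in> Lam"
      by (intro subgrp_diff subgrp_Lam order_Lam lam uv)
    hence "(?a * u' - ?b * u, ?a * v' - ?b * v) \<in> Lam" by (simp add: cscale_def)
    moreover have "p * (?a * u' - ?b * u) + q * (?a * v' - ?b * v) = 0" by (simp add: algebra_simps)
    \<comment> \<open>the Pluecker relation \<open>\<lambda>(w) det(x, y) = \<lambda>(x) det(w, y) - \<lambda>(y) det(w, x)\<close>\<close>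
    moreover have "u * v' - u' * v = w1 * (?a * v' - ?b * v) - w2 * (?a * u' - ?b * u)"
      using w(2) by algebra
    ultimately show ?thesis unfolding D_def by blast
  qed
  have M_D: "?M \<subseteq> D"
  proof
    fix m assume "m \<in> ?M"
    then obtain x y k where m: "m = x + \<tau>1 * y + of_int k * z" "x \<in> lat \<tau>2" "y \<in> lat \<tau>2"
      by (auto simp: prod_lat_def)
    \<comment> \<open>Pairing \<open>(x, 0)\<close> with \<open>(0, 1)\<close>,
      \<open>(y, 0)\<close> with \<open>(z, \<tau>1)\<close>, and \<open>(z, \<tau>1)\<close> with
      \<open>(0, 1)\<close> realizes the three kinds of generators.\<close>
    have "x \<in> D" using det_D[of x 0 0 1] generators_in_Lam m Lam_zero_iff by simp
    moreover have "\<tau>1 * y \<in> D"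
      using det_D[of y 0 z \<tau>1] generators_in_Lam m Lam_zero_iff by (simp add: mult.commute)
    moreover have "z \<in> D" using det_D[of z \<tau>1 0 1] generators_in_Lam by simp
    ultimately show "m \<in> D" unfolding m by (intro subgrp_add subgrp_int_mult D)
  qed
  have "?f ` Lam = lat \<theta> \<times> ?M"
  proof (intro equalityI subsetI)
    fix x assume "x \<in> ?f ` Lam"
    then obtain u v where "(u, v) \<in> Lam" "x = (p * u + q * v, w1 * v - w2 * u)" by auto
    thus "x \<in> lat \<theta> \<times> ?M" using lam det by simp
  next
    fix x assume "x \<in> lat \<theta> \<times> ?M"
    then obtain a m where x: "x = (a, m)" "a \<in> lat \<theta>" "m \<in> D" using M_D by (elim SigmaE) blast
    then obtain u v where uv: "(u, v) \<in> Lam" "p * u + q * v = 0" "m = w1 * v - w2 * u"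
      by (auto simp: D_def)
    \<comment> \<open>The preimage is assembled from the two summands: \<open>a\<close> times
      \<open>(w1, w2)\<close> and a kernel vector of determinant \<open>m\<close>.\<close>
    have "cscale a (w1, w2) + (u, v) \<in> Lam" by (intro subgrp_add subgrp_Lam order_Lam x w uv)
    hence "(a * w1 + u, a * w2 + v) \<in> Lam" by (simp add: cscale_def)
    moreover have "p * (a * w1 + u) + q * (a * w2 + v) = a" using w(2) uv(2) by algebra
    moreover have "- w2 * (a * w1 + u) + w1 * (a * w2 + v) = m" by (simp add: uv algebra_simps)
    ultimately show "x \<in> ?f ` Lam"
      unfolding x by (intro image_eqI[of _ _ "(a * w1 + u, a * w2 + v)"]) auto
  qed
  moreover have "p * w1 - q * (- w2) \<noteq> 0" using w(2) by simp
  ultimately show ?thesis unfolding tori_iso_def by blast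
qed

lemma zspan_columns_eq_Lam: "zspan {(\<tau>2, 0), (1, 0), (z, \<tau>1), (0, 1)} = Lam"
proof (rule zspan_eqI[OF subgrp_Lam])
  let ?S = "{(\<tau>2, 0), (1, 0), (z, \<tau>1), (0, 1)}"
  show "?S \<subseteq> Lam" using generators_in_Lam by simp
  show "Lam \<subseteq> zspan ?S"
  proof
    fix w assume "w \<in> Lam"
    then obtain u a b where w: "w = (u, of_int a * \<tau>1 + of_int b)" "u - of_int a * z \<in> lat \<tau>2"
      by (elim Lam_cases)
    obtain r s where "u - of_int a * z = of_int r + of_int s * \<tau>2"
      using w(2) by (auto simp: lat_def)
    hence "u = of_int a * z + of_int r + of_int s * \<tau>2" by (simp add: algebra_simps)
    hence "w = of_int s *\<^sub>R (\<tau>2, 0) + of_int r *\<^sub>R (1, 0) + of_int a *\<^sub>R (z, \<tau>1) + of_int b *\<^sub>R (0, 1)"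
      by (simp add: w scaleR_conv_of_real)
    also have "\<dots> \<in> zspan ?S"
      by (intro subgrp_add subgrp_int_scaleR subgrp_zspan set_mp[OF zspan_superset]) auto
    finally show "w \<in> zspan ?S" .
  qed
qed

end

text \<open>The field-theoretic data are reduced to the integers of \<open>cm_extension\<close>,
  where \<open>lat \<theta>\<close> becomes the order of conductor \<open>n * lcm f1 f2\<close> and
  \<open>Lam\<close> the span of the columns.\<close>

theorem theorem2p5:
  fixes K :: "complex set" and \<tau>1 \<tau>2 z :: complex and f1 f2 n :: nat
  assumes "imag_quadratic_field K"
    and "\<tau>1 \<in> K" and "\<tau>2 \<in> K" and "Im \<tau>1 \<noteq> 0" and "Im \<tau>2 \<noteq> 0"
    and "is_conductor K (zspan {1, \<tau>1}) f1"
    and "is_conductor K (zspan {1, \<tau>2}) f2"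
    and "n \<ge> 1"
    and "of_nat n * z \<in> prod_lattice (zspan {1, \<tau>1}) (zspan {1, \<tau>2})"
    and "\<forall>k. 0 < k \<and> k < n \<longrightarrow> of_nat k * z \<notin> prod_lattice (zspan {1, \<tau>1}) (zspan {1, \<tau>2})"
  shows "tori_iso (zspan {(\<tau>2, 0), (1, 0), (z, \<tau>1), (0, 1)})
           (order_cond K (n * lcm f1 f2)
              \<times> zspan (insert z (prod_lattice (zspan {1, \<tau>1}) (zspan {1, \<tau>2}))))"
proof -
  note K = assms(1) and Im = assms(4,5)
  note cond = assms(6,7)[unfolded zspan_pair_eq_lat]
  note nz = assms(9,10)[unfolded zspan_pair_eq_lat prod_lattice_eq_prod_lat]
  have fpos: "f1 > 0" "f2 > 0" using cond by (auto simp: is_conductor_def)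
  obtain A1 B1 C1 where 1: "gcd A1 (gcd B1 C1) = 1"
      "of_int A1 * \<tau>1\<^sup>2 + of_int B1 * \<tau>1 + of_int C1 = 0"
    using primitive_quadratic_equation[OF K assms(2)] .
  obtain A B C where 2: "gcd A (gcd B C) = 1" "of_int A * \<tau>2\<^sup>2 + of_int B * \<tau>2 + of_int C = 0"
    using primitive_quadratic_equation[OF K assms(3)] .
  have ord1: "order_cond K f1 = lat (of_int A1 * \<tau>1)"
    by (rule conductor_order_eq[OF K assms(2) Im(1) 1 cond(1)])
  have ord2: "order_cond K f2 = lat (of_int A * \<tau>2)"
    by (rule conductor_order_eq[OF K assms(3) Im(2) 2 cond(2)])
  have "A1 \<noteq> 0" by (rule primitive_lead_nonzero[OF Im(1) 1])
  hence "Im (of_int A1 * \<tau>1) \<noteq> 0" using Im(1) by simp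
  then obtain \<omega> k1 T N where \<omega>: "of_nat f1 * \<omega> = of_int A1 * \<tau>1 + of_int k1" "Im \<omega> \<noteq> 0"
    "\<omega>\<^sup>2 = of_int T * \<omega> - of_int N" "ring_of_integers K = lat \<omega>"
    using ring_of_integers_generator[OF K _ fpos(1) ord1] by blast
  have "lat (of_nat f2 * \<omega>) = lat (of_int A * \<tau>2)" using ord2 order_cond_eq_lat[OF \<omega>(4)] by simp
  moreover have "Im (of_nat f2 * \<omega>) \<noteq> 0" using \<omega>(2) fpos by simp
  \<comment> \<open>\<open>\<omega>\<close> was chosen to fit \<open>\<tau>1\<close>; for
    \<open>\<tau>2\<close> it fits only up to the sign \<open>e\<close>, which is absorbed by
    passing to \<open>e * A\<close>, \<open>e * B\<close>, \<open>e * C\<close>.\<close>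
  ultimately obtain e k2 where e: "\<bar>e\<bar> = 1" "of_nat f2 * \<omega> = of_int e * (of_int A * \<tau>2) + of_int k2"
    using lat_eq_imp_generators by blast
  define g where "g = gcd f1 f2"
  have g: "g > 0" using fpos by (simp add: g_def)
  \<comment> \<open>The cofactors are named crosswise, so that \<open>m1\<close> is the least common
    multiple divided by \<open>f1\<close>, and \<open>m2\<close> the same for
    \<open>f2\<close>.\<close>
  obtain m2 m1 where m: "f1 = g * m2" "f2 = g * m1" "coprime m2 m1"
    unfolding g_def
      using gcd_coprime_exists[of f1 f2] fpos by (metis mult.commute gcd_eq_0_iff not_gr_zero)
  have lcm: "lcm f1 f2 = g * m1 * m2"
    using m by (simp add: lcm_mult_left lcm_coprime mult_ac)
  have mpos: "m1 > 0" "m2 > 0" using fpos m by auto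
  interpret cm_extension \<omega> \<tau>1 \<tau>2 z T N A1 B1 C1 k1 "e * A" "e * B" "e * C" k2 "int g" "int m1"
      "int m2" "int n"
  proof
    have "e = 1 \<or> e = -1" using e(1) by linarith
    thus "gcd (e * A) (gcd (e * B) (e * C)) = 1" using 2(1) by auto
    show "of_int (e * A) * \<tau>2\<^sup>2 + of_int (e * B) * \<tau>2 + of_int (e * C) = 0"
      using 2(2) unfolding of_int_mult by algebra
    show "of_int (int g * int m2) * \<omega> = of_int A1 * \<tau>1 + of_int k1" using \<omega>(1) by (simp add: m)
    show "of_int (int g * int m1) * \<omega> = of_int (e * A) * \<tau>2 + of_int k2" using e(2) by (simp add: m)
    show "coprime (int m1) (int m2)" using m(3) by (simp add: coprime_commute)
    fix k assume "0 < k" "k < int n"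
    thus "of_int k * z \<notin> prod_lat \<tau>1 \<tau>2" using nz(2)[rule_format, of "nat k"] by simp
  qed (use \<omega> Im 1 g mpos assms(8) nz in auto)
  have "order_cond K (n * lcm f1 f2) = lat (of_nat (n * lcm f1 f2) * \<omega>)"
    by (rule order_cond_eq_lat[OF \<omega>(4)])
  also have "of_nat (n * lcm f1 f2) * \<omega> = \<theta>" by (simp add: lcm theta_eq)
  finally show ?thesis
    using Lam_tori_iso
      by (simp only: zspan_pair_eq_lat prod_lattice_eq_prod_lat zspan_insert_prod_lat zspan_columns_eq_Lam)
qed

end
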